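(* Let $p$ be a prime, $n\ge 0$ an integer, and $P$ a nontrivial finite $p$-group of nilpotence class at most $n(p-1)+1$. Let $\mathcal F$ be a saturated fusion system on $P$. Then $\mho^n(Z(P))$ is normal in $\mathcal F$.
   Context: $\mho^n(A)$ denotes the subgroup of the group $A$ generated by all $p^n$-th powers of elements of $A$. A category on $P$ has as objects the subgroups of $P$, with $\mathrm{Hom}_{\mathcal F}(Q,R)$ a set of injective group homomorphisms $Q\to R$ such that every morphism is an $\mathcal F$-isomorphism followed by an inclusion. A saturated fusion system on $P$ is such a category containing all homomorphisms induced by conjugation by elements of $P$, in which $\mathrm{Aut}_P(P)$ is a Sylow $p$-subgroup of $\mathrm{Aut}_{\mathcal F}(P)$, and such that for every $\mathcal F$-isomorphism $\varphi: Q\to Q'$ with $Q'$ fully $\mathcal F$-normalized (i.e. $|N_P(Q')|\ge |N_P(Q'')|$ for all $Q''$ $\mathcal F$-isomorphic to $Q'$), $\varphi$ extends to an $\mathcal F$-morphism $N_\varphi\to P$, where $N_\varphi=\{x\in N_P(Q): \exists y\in N_P(\varphi(Q))\ \forall z\in Q,\ \varphi(xzx^{-1})=y\varphi(z)y^{-1}\}$. For $W\le P$, $N_{\mathcal F}(W)$ is the category on $N_P(W)$ whose morphisms $R_1\to R_2$ are those $\mathcal F$-morphisms $\varphi$ admitting an extension $\tilde\varphi: WR_1\to WR_2$ in $\mathcal F$ with $\tilde\varphi(W)=W$. $W$ is normal in $\mathcal F$ if $\mathcal F = N_{\mathcal F}(W)$. *)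

theory Defs
  imports "HOL-Algebra.Algebra"
begin

definition grp_center :: "('a, 'b) monoid_scheme \<Rightarrow> 'a set" where
  "grp_center G = {z \<in> carrier G. \<forall>x \<in> carrier G. x \<otimes>\<^bsub>G\<^esub> z = z \<otimes>\<^bsub>G\<^esub> x}"

definition comm_subgroup :: "('a, 'b) monoid_scheme \<Rightarrow> 'a set \<Rightarrow> 'a set \<Rightarrow> 'a set" where
  "comm_subgroup G A B = generate G
     {a \<otimes>\<^bsub>G\<^esub> b \<otimes>\<^bsub>G\<^esub> inv\<^bsub>G\<^esub> a \<otimes>\<^bsub>G\<^esub> inv\<^bsub>G\<^esub> b | a b. a \<in> A \<and> b \<in> B}"

text \<open>Lower central series, shifted: lower_central G i = gamma_(i+1)(G).\<close>
fun lower_central :: "('a, 'b) monoid_scheme \<Rightarrow> nat \<Rightarrow> 'a set" where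
  "lower_central G 0 = carrier G"
| "lower_central G (Suc i) = comm_subgroup G (lower_central G i) (carrier G)"

definition nilpotent_class_le :: "('a, 'b) monoid_scheme \<Rightarrow> nat \<Rightarrow> bool" where
  "nilpotent_class_le G c \<longleftrightarrow> lower_central G c = {\<one>\<^bsub>G\<^esub>}"

definition p_group :: "nat \<Rightarrow> ('a, 'b) monoid_scheme \<Rightarrow> bool" where
  "p_group p G \<longleftrightarrow> group G \<and> finite (carrier G) \<and> (\<exists>k. card (carrier G) = p ^ k)"

definition mho :: "('a, 'b) monoid_scheme \<Rightarrow> nat \<Rightarrow> nat \<Rightarrow> 'a set \<Rightarrow> 'a set" where
  "mho G p n A = generate G {a [^]\<^bsub>G\<^esub> (p ^ n) | a. a \<in> A}"

definition conjm :: "('a, 'b) monoid_scheme \<Rightarrow> 'a \<Rightarrow> 'a \<Rightarrow> 'a" where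
  "conjm G x z = x \<otimes>\<^bsub>G\<^esub> z \<otimes>\<^bsub>G\<^esub> inv\<^bsub>G\<^esub> x"

definition normalizer_in :: "('a, 'b) monoid_scheme \<Rightarrow> 'a set \<Rightarrow> 'a set" where
  "normalizer_in G Q = {x \<in> carrier G. conjm G x ` Q = Q}"

text \<open>A morphism set is a function Hom Q R of maps Q -> R; maps are represented as
  functions extensional on their domain Q.\<close>
type_synonym 'a homs = "'a set \<Rightarrow> 'a set \<Rightarrow> ('a \<Rightarrow> 'a) set"

definition inj_homs :: "('a, 'b) monoid_scheme \<Rightarrow> 'a set \<Rightarrow> 'a set \<Rightarrow> ('a \<Rightarrow> 'a) set" where
  "inj_homs G Q R = {\<phi>. \<phi> \<in> extensional Q \<and> inj_on \<phi> Q \<and> \<phi> ` Q \<subseteq> R \<and>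
      (\<forall>a \<in> Q. \<forall>b \<in> Q. \<phi> (a \<otimes>\<^bsub>G\<^esub> b) = \<phi> a \<otimes>\<^bsub>G\<^esub> \<phi> b)}"

definition fusion_category :: "('a, 'b) monoid_scheme \<Rightarrow> 'a homs \<Rightarrow> bool" where
  "fusion_category P Hom \<longleftrightarrow>
     (\<forall>Q R. Hom Q R \<noteq> {} \<longrightarrow> subgroup Q P \<and> subgroup R P)
   \<and> (\<forall>Q R. Hom Q R \<subseteq> inj_homs P Q R)
   \<and> (\<forall>Q. subgroup Q P \<longrightarrow> restrict id Q \<in> Hom Q Q)
   \<and> (\<forall>Q R S \<phi> \<psi>. \<phi> \<in> Hom Q R \<longrightarrow> \<psi> \<in> Hom R S \<longrightarrow> restrict (\<psi> \<circ> \<phi>) Q \<in> Hom Q S)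
   \<and> (\<forall>Q R \<phi>. \<phi> \<in> Hom Q R \<longrightarrow>
        \<phi> \<in> Hom Q (\<phi> ` Q) \<and> restrict (inv_into Q \<phi>) (\<phi> ` Q) \<in> Hom (\<phi> ` Q) Q \<and>
        restrict id (\<phi> ` Q) \<in> Hom (\<phi> ` Q) R)"

definition F_iso :: "'a homs \<Rightarrow> 'a set \<Rightarrow> 'a set \<Rightarrow> ('a \<Rightarrow> 'a) \<Rightarrow> bool" where
  "F_iso Hom Q R \<phi> \<longleftrightarrow> \<phi> \<in> Hom Q R \<and> \<phi> ` Q = R"

definition F_isomorphic :: "'a homs \<Rightarrow> 'a set \<Rightarrow> 'a set \<Rightarrow> bool" where
  "F_isomorphic Hom Q R \<longleftrightarrow> (\<exists>\<phi>. F_iso Hom Q R \<phi>)"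

definition fully_normalized :: "('a, 'b) monoid_scheme \<Rightarrow> 'a homs \<Rightarrow> 'a set \<Rightarrow> bool" where
  "fully_normalized P Hom Q \<longleftrightarrow> subgroup Q P \<and>
     (\<forall>Q''. F_isomorphic Hom Q Q'' \<longrightarrow>
        card (normalizer_in P Q'') \<le> card (normalizer_in P Q))"

definition N_phi :: "('a, 'b) monoid_scheme \<Rightarrow> 'a set \<Rightarrow> ('a \<Rightarrow> 'a) \<Rightarrow> 'a set" where
  "N_phi P Q \<phi> = {x \<in> normalizer_in P Q. \<exists>y \<in> normalizer_in P (\<phi> ` Q).
        \<forall>z \<in> Q. \<phi> (conjm P x z) = conjm P y (\<phi> z)}"

definition Aut_P :: "('a, 'b) monoid_scheme \<Rightarrow> ('a \<Rightarrow> 'a) set" where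
  "Aut_P P = {restrict (conjm P x) (carrier P) | x. x \<in> carrier P}"

text \<open>Sylow p-subgroup of the finite group Aut_F(P) (under composition): a p-subgroup
  whose index is prime to p.\<close>
definition sylow_sub :: "nat \<Rightarrow> ('c set) \<Rightarrow> ('c set) \<Rightarrow> bool" where
  "sylow_sub p S A \<longleftrightarrow> S \<subseteq> A \<and> (\<exists>k. card S = p ^ k) \<and> \<not> p dvd (card A div card S)"

definition saturated_fusion_system :: "nat \<Rightarrow> ('a, 'b) monoid_scheme \<Rightarrow> 'a homs \<Rightarrow> bool" where
  "saturated_fusion_system p P Hom \<longleftrightarrow>
     fusion_category P Hom
   \<and> (\<forall>Q R x. subgroup Q P \<longrightarrow> subgroup R P \<longrightarrow> x \<in> carrier P \<longrightarrow>
        conjm P x ` Q \<subseteq> R \<longrightarrow> restrict (conjm P x) Q \<in> Hom Q R)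
   \<and> sylow_sub p (Aut_P P) (Hom (carrier P) (carrier P))
   \<and> (\<forall>Q Q' \<phi>. F_iso Hom Q Q' \<phi> \<longrightarrow> fully_normalized P Hom Q' \<longrightarrow>
        (\<exists>\<psi> \<in> Hom (N_phi P Q \<phi>) (carrier P). \<forall>z \<in> Q. \<psi> z = \<phi> z))"

text \<open>W normal in F: F = N_F(W). Equality of object sets forces N_P(W) = P; every
  F-morphism Q -> R then has an extension WQ -> WR in F mapping W onto W.\<close>
definition normal_in_fusion :: "('a, 'b) monoid_scheme \<Rightarrow> 'a homs \<Rightarrow> 'a set \<Rightarrow> bool" where
  "normal_in_fusion P Hom W \<longleftrightarrow> subgroup W P \<and> normalizer_in P W = carrier P \<and>
     (\<forall>Q R \<phi>. subgroup Q P \<longrightarrow> subgroup R P \<longrightarrow> \<phi> \<in> Hom Q R \<longrightarrow>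
        (\<exists>\<psi> \<in> Hom (W <#>\<^bsub>P\<^esub> Q) (W <#>\<^bsub>P\<^esub> R). (\<forall>z \<in> Q. \<psi> z = \<phi> z) \<and> \<psi> ` W = W))"

end

theory Submission
  imports Defs "HOL-Number_Theory.Cong" "HOL-Computational_Algebra.Polynomial"
begin

text \<open>
  Write \<open>W\<close> for the subgroup in question. By downward induction on \<open>|Q|\<close> every morphism
  \<open>Q \<rightarrow> P\<close> extends to \<open>WQ\<close> mapping \<open>W\<close> onto itself. Composing with morphisms onto a fully
  normalized conjugate, which may be chosen to extend to normalizers, reduces this to an
  automorphism of a fully normalized \<open>Q < P\<close>. If \<open>C(Q)\<close> is not contained in \<open>Q\<close>, the automorphism
  extends to a larger subgroup. Otherwise \<open>W\<close> lies in the group \<open>X\<close> of \<open>p ^ n\<close>-th powers of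
  \<open>Z(Q)\<close>, and the automorphisms trivial on \<open>X\<close> form a normal subgroup \<open>K\<close> of \<open>Aut(Q)\<close>. As
  \<open>Aut\<^sub>P(Q)\<close> is a Sylow subgroup, the Frattini argument writes the automorphism as \<open>\<kappa> \<nu>\<close> with
  \<open>\<kappa> \<in> K\<close> and \<open>\<nu>\<close> normalizing \<open>K \<inter> Aut\<^sub>P(Q)\<close>. Now take \<open>x \<in> N(Q) - Q\<close> with \<open>x ^ p \<in> Q\<close>. It acts
  on \<open>Z(Q)\<close> as some \<open>\<sigma>\<close> with \<open>\<sigma> ^ p = 1\<close> and, by the bound on the class,
  \<open>(\<sigma> - 1) ^ (n (p - 1) + 1) = 0\<close>. These relations force \<open>p ^ n (\<sigma> - 1) = 0\<close>, so conjugation by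
  \<open>x\<close> lies in \<open>K\<close>; hence \<open>\<nu>\<close> extends to a subgroup containing \<open>x\<close> and preserves \<open>W\<close> by induction.
\<close>

hide_const (open) Polynomial.order

section \<open>Sylow theory of finite groups\<close>

no_notation (input) subset_mset  (infix \<open><#\<close> 50)

text \<open>Orbit sizes are powers of \<open>p\<close>, so an orbit is either a single fixed point
  or has size divisible by \<open>p\<close>. Adding up the orbits, the number of points that are not
  fixed is divisible by \<open>p\<close>.\<close>

lemma (in group_action) p_group_fixed_points:
  assumes p: "Factorial_Ring.prime (p::nat)" and ord: "order G = p ^ k" and fin: "finite E"
  shows "[card {x \<in> E. \<forall>g \<in> carrier G. \<phi> g x = x} = card E] (mod p)"
proof -
  define Fix where "Fix = {x \<in> E. \<forall>g \<in> carrier G. \<phi> g x = x}"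
  have FixE: "Fix \<subseteq> E" by (auto simp: Fix_def)
  \<comment> \<open>The summand is the indicator of the points that are not fixed;
    \<open>disjoint_sum\<close> later turns the sums over orbits into the size of
    \<open>E - Fix\<close>.\<close>
  have orb_dvd: "p dvd (\<Sum>x\<in>orb. if x \<in> Fix then 0 else 1)" if o: "orb \<in> orbits G E \<phi>" for orb
  proof -
    obtain x where x: "x \<in> E" and orb: "orb = orbit G \<phi> x" using o by (auto simp: orbits_def)
    show ?thesis
    proof (cases "orb \<inter> Fix = {}")
      case True
      have "orb \<subseteq> E" unfolding orb orbit_def using element_image[OF _ x] by blast
      then have finorb: "finite orb" using fin finite_subset by blast
      have "card orb dvd p ^ k"
        using orbit_stabilizer_theorem[OF x] ord unfolding orb by (metis dvd_triv_left)
      then obtain i where i: "card orb = p ^ i" using divides_primepow_nat[OF p] by blast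
      have xo: "x \<in> orb" unfolding orb using orbit_refl[OF x] .
      have "i \<noteq> 0"
      proof
        assume "i = 0"
        then have "card orb = 1" using i by simp
        then have "orb = {x}" using xo by (metis card_1_singletonE singletonD)
        then have "\<forall>g \<in> carrier G. \<phi> g x = x" unfolding orb orbit_def by blast
        then show False using True xo x by (auto simp: Fix_def)
      qed
      then have "p dvd card orb" using i by (simp add: dvd_power)
      moreover have "(\<Sum>x\<in>orb. if x \<in> Fix then 0 else 1::nat) = card orb"
        using True by (subst sum.cong[OF refl, of _ _ "\<lambda>_. 1"]) auto
      ultimately show ?thesis by simp
    next
      case False
      then obtain y where y: "y \<in> orb" "y \<in> Fix" by blast
      then have "x \<in> orbit G \<phi> y" using orbit_sym[OF x] FixE unfolding orb by blast
      then have "x = y" using y(2) unfolding Fix_def orbit_def by auto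
      then have fx: "\<phi> g x = x" if "g \<in> carrier G" for g
        using y(2) that by (simp add: Fix_def)
      then have "orb \<subseteq> {y}" unfolding orb orbit_def using \<open>x = y\<close> by auto
      then have "orb = {y}" using y(1) by blast
      then show ?thesis using y by simp
    qed
  qed
  have "p dvd (\<Sum>orb\<in>orbits G E \<phi>. \<Sum>x\<in>orb. if x \<in> Fix then 0 else 1)"
    using orb_dvd by (rule dvd_sum)
  then have "p dvd (\<Sum>x\<in>E. if x \<in> Fix then 0 else 1)" by (simp only: disjoint_sum[OF fin])
  also have "(\<Sum>x\<in>E. if x \<in> Fix then 0 else 1::nat) = (\<Sum>x\<in>E - Fix. 1)"
    using fin by (intro sum.mono_neutral_cong_right) auto
  also have "\<dots> = card E - card Fix" using FixE fin by (simp add: card_Diff_subset finite_subset)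
  finally have "p dvd card E - card Fix" .
  moreover have "card Fix \<le> card E" using FixE fin by (simp add: card_mono)
  ultimately show ?thesis unfolding Fix_def[symmetric]
    by (metis cong_altdef_nat cong_sym)
qed

section \<open>Counting fixed cosets: Sylow conjugation, growing normalizers, the Frattini
  argument\<close>

context group
begin

text \<open>Provides the action to which orbit counting is applied. The maps are restricted to
  \<open>lcosets S\<close> because the elements of \<open>Bij\<close> are extensional.\<close>

lemma lcosets_action:
  assumes "subgroup S G"
  shows "group_action G (lcosets S) (\<lambda>g. \<lambda>C \<in> lcosets S. g <# C)"
proof -
  let ?a = "\<lambda>g. \<lambda>C \<in> lcosets S. g <# C"
  have sub: "C \<subseteq> carrier G" if "C \<in> lcosets S" for C
    using that lcosets_subset_PowG[OF assms] by blast
  have cl: "g <# C \<in> lcosets S" if g: "g \<in> carrier G" and C: "C \<in> lcosets S" for g C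
  proof -
    obtain x where x: "x \<in> carrier G" "C = x <# S" using C unfolding LCOSETS_def by blast
    then have "g <# C = (g \<otimes> x) <# S"
      using g lcos_m_assoc[OF subgroup.subset[OF assms], of g x] by simp
    then show ?thesis using x g unfolding LCOSETS_def by auto
  qed
  have m: "g <# (h <# C) = (g \<otimes> h) <# C" if "g \<in> carrier G" "h \<in> carrier G" "C \<in> lcosets S" for g h C
    using lcos_m_assoc[OF sub[OF that(3)] that(1,2)] .
  have o: "\<one> <# C = C" if "C \<in> lcosets S" for C
    using lcos_mult_one[OF sub[OF that]] .
  have bij: "?a g \<in> Bij (lcosets S)" if g: "g \<in> carrier G" for g
    unfolding Bij_def
  proof (safe)
    show "bij_betw (?a g) (lcosets S) (lcosets S)"
      by (rule bij_betw_byWitness[where f' = "?a (inv g)"])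
         (use g in \<open>auto simp: cl m o\<close>)
  qed simp
  show ?thesis unfolding group_action_def
  proof (rule group_hom.intro)
    show "group G" by (rule is_group)
    show "group (BijGroup (lcosets S))" by (rule group_BijGroup)
    show "group_hom_axioms G (BijGroup (lcosets S)) ?a"
    proof (intro group_hom_axioms.intro homI)
      fix x assume "x \<in> carrier G"
      then show "?a x \<in> carrier (BijGroup (lcosets S))" using bij by (simp add: BijGroup_def)
    next
      fix x y assume xy: "x \<in> carrier G" "y \<in> carrier G"
      have "?a (x \<otimes> y) = compose (lcosets S) (?a x) (?a y)"
        unfolding compose_def using xy by (intro restrict_ext) (simp add: cl m)
      then show "?a (x \<otimes> y) = ?a x \<otimes>\<^bsub>BijGroup (lcosets S)\<^esub> ?a y"
        using bij xy by (simp add: BijGroup_def)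
    qed
  qed
qed

lemma card_fixed_lcosets:
  assumes p: "Factorial_Ring.prime (p::nat)" and fin: "finite (carrier G)"
    and S: "subgroup S G" and T: "subgroup T G" "card T = p ^ k"
  shows "[card {C \<in> lcosets S. \<forall>t \<in> T. t <# C = C} = order G div card S] (mod p)"
proof -
  interpret group_action "G\<lparr>carrier := T\<rparr>" "lcosets S" "\<lambda>g. \<lambda>C \<in> lcosets S. g <# C"
    by (rule group_action.induced_action[OF lcosets_action[OF S] T(1)])
  have finl: "finite (lcosets S)"
    using finite_subset[OF lcosets_subset_PowG[OF S]] fin by simp
  have "card S > 0" using S fin
    by (metis card_gt_0_iff finite_subset subgroup.subset subgroup_nonempty)
  then have "card (lcosets S) = order G div card S"
    using l_lagrange[OF fin S] by (metis nonzero_mult_div_cancel_right less_not_refl2)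
  moreover have "[card {x \<in> lcosets S. \<forall>g \<in> T. (\<lambda>C \<in> lcosets S. g <# C) x = x} = card (lcosets S)] (mod p)"
    using p_group_fixed_points[OF p _ finl, of k] T(2) by (simp add: Coset.order_def)
  moreover have "{x \<in> lcosets S. \<forall>g \<in> T. (\<lambda>C \<in> lcosets S. g <# C) x = x} =
     {C \<in> lcosets S. \<forall>t \<in> T. t <# C = C}" by auto
  ultimately show ?thesis by simp
qed

text \<open>Since \<open>t \<otimes> x\<close> lies in \<open>t <# (x <# S) = x <# S\<close>, a
  fixed coset amounts to a conjugation into \<open>S\<close>.\<close>

lemma fixed_lcoset_conj:
  assumes S: "subgroup S G" and x: "x \<in> carrier G" and t: "t \<in> carrier G"
    and f: "t <# (x <# S) = x <# S"
  shows "inv x \<otimes> t \<otimes> x \<in> S"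
proof -
  have "t \<otimes> x \<in> t <# (x <# S)"
    unfolding l_coset_def[of G t] using lcos_self[OF x S] by blast
  then obtain s where "s \<in> S" "t \<otimes> x = x \<otimes> s" using f by (auto simp: l_coset_def)
  then have "inv x \<otimes> (t \<otimes> x) = s"
    using x subgroup.mem_carrier[OF S] by (simp add: m_assoc[symmetric])
  then show ?thesis using x t \<open>s \<in> S\<close> by (simp add: m_assoc)
qed

text \<open>The number of cosets of \<open>S\<close> fixed by \<open>T\<close> is congruent to the
  index of \<open>S\<close>, which is prime to \<open>p\<close>; so some coset is fixed, and its
  representative conjugates \<open>T\<close> into \<open>S\<close>.\<close>

lemma p_subgroup_conj_into_Sylow:
  assumes p: "Factorial_Ring.prime (p::nat)" and fin: "finite (carrier G)"
    and S: "subgroup S G" "\<not> p dvd order G div card S" and T: "subgroup T G" "card T = p ^ k"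
  obtains h where "h \<in> carrier G" "\<And>t. t \<in> T \<Longrightarrow> inv h \<otimes> t \<otimes> h \<in> S"
proof -
  have "\<not> p dvd card {C \<in> lcosets S. \<forall>t \<in> T. t <# C = C}"
    using card_fixed_lcosets[OF p fin S(1) T] S(2) cong_dvd_iff by blast
  then have "{C \<in> lcosets S. \<forall>t \<in> T. t <# C = C} \<noteq> {}"
    by (metis card.empty dvd_0_right)
  then obtain x where x: "x \<in> carrier G" "\<forall>t \<in> T. t <# (x <# S) = x <# S"
    by (auto simp: LCOSETS_def)
  show thesis
    by (rule that[OF x(1)]) (use x fixed_lcoset_conj[OF S(1) x(1)] subgroup.mem_carrier[OF T(1)] in blast)
qed

text \<open>The coset \<open>T\<close> is fixed by \<open>T\<close>, and the number of fixed cosets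
  is divisible by \<open>p\<close>. Hence there is a second fixed coset, and its representative
  normalizes \<open>T\<close> without lying in it.\<close>

lemma p_subgroup_normalizer_grows:
  assumes p: "Factorial_Ring.prime (p::nat)" and fin: "finite (carrier G)"
    and T: "subgroup T G" "card T = p ^ k" and d: "p dvd order G div card T"
  obtains x where "x \<in> carrier G" "x \<notin> T" "\<And>t. t \<in> T \<Longrightarrow> inv x \<otimes> t \<otimes> x \<in> T"
proof -
  let ?F = "{C \<in> lcosets T. \<forall>t \<in> T. t <# C = C}"
  have "p dvd card ?F"
    using card_fixed_lcosets[OF p fin T(1) T] d cong_dvd_iff by blast
  have lT: "t <# T = T" if "t \<in> T" for t
    using that T(1) by (metis coset_join3 subgroup.mem_carrier)
  have finl: "finite (lcosets T)"
    using finite_subset[OF lcosets_subset_PowG[OF T(1)]] fin by simp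
  have "T \<in> lcosets T" using lT[of \<one>] T(1) by (auto simp: LCOSETS_def subgroup.one_closed)
  then have "T \<in> ?F" using lT by simp
  have "?F \<noteq> {T}"
  proof
    assume "?F = {T}"
    then have "card ?F = 1" by simp
    then show False using \<open>p dvd card ?F\<close> p not_prime_unit by metis
  qed
  then obtain C where C: "C \<in> ?F" "C \<noteq> T" using \<open>T \<in> ?F\<close> by blast
  then obtain x where x: "x \<in> carrier G" "C = x <# T" by (auto simp: LCOSETS_def)
  show thesis
  proof (rule that[OF x(1)])
    show "x \<notin> T" using C(2) x(2) lT by blast
    show "inv x \<otimes> t \<otimes> x \<in> T" if "t \<in> T" for t
      using that C(1) x fixed_lcoset_conj[OF T(1) x(1)] subgroup.mem_carrier[OF T(1)] by blast
  qed
qed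

lemma card_subgroup_dvd:
  assumes "subgroup H G" shows "card H dvd order G"
  using lagrange[OF assms] by (metis dvd_triv_right)

lemma subgroup_of_subgroup:
  assumes "subgroup H G" "subgroup K G" "H \<subseteq> K"
  shows "subgroup H (G\<lparr>carrier := K\<rparr>)"
  using assms by (simp add: subgroup_incl)

text \<open>Inside the \<open>p\<close>-group \<open>U\<close> the index of a proper subgroup is
  divisible by \<open>p\<close>, so the counting argument applies there.\<close>

lemma proper_p_subgroup_normalizer_grows:
  assumes p: "Factorial_Ring.prime (p::nat)" and U: "subgroup U G" "card U = p ^ a"
    and T: "subgroup T G" "T \<subset> U"
  obtains x where "x \<in> U" "x \<notin> T" "\<And>t. t \<in> T \<Longrightarrow> inv x \<otimes> t \<otimes> x \<in> T"
proof -
  interpret U: group "G\<lparr>carrier := U\<rparr>" using subgroup_imp_group[OF U(1)] .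
  have finU: "finite U" using U(2) p
    by (metis card_ge_0_finite prime_gt_0_nat zero_less_power)
  have TU: "subgroup T (G\<lparr>carrier := U\<rparr>)"
    using subgroup_of_subgroup[OF T(1) U(1)] T(2) by blast
  have "card T dvd p ^ a" using U.card_subgroup_dvd[OF TU] U(2) by (simp add: Coset.order_def)
  then obtain b where b: "b \<le> a" "card T = p ^ b" using divides_primepow_nat[OF p] by blast
  have "card T < card U" using T(2) finU by (simp add: psubset_card_mono)
  then have "b < a" using b U(2) p by (metis nat_less_le)
  then have "p dvd card U div card T"
    using b U(2) p by (simp add: power_diff[symmetric] prime_gt_0_nat dvd_power)
  then obtain x where "x \<in> U" "x \<notin> T" "\<And>t. t \<in> T \<Longrightarrow> inv\<^bsub>G\<lparr>carrier := U\<rparr>\<^esub> x \<otimes> t \<otimes> x \<in> T"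
    using U.p_subgroup_normalizer_grows[OF p _ TU b(2)] finU by (auto simp: Coset.order_def)
  then show thesis using that m_inv_consistent[OF U(1)] by metis
qed

lemma conj_subgroup:
  assumes U: "subgroup U G" and h: "h \<in> carrier G"
  shows "subgroup ((\<lambda>u. h \<otimes> u \<otimes> inv h) ` U) G" "card ((\<lambda>u. h \<otimes> u \<otimes> inv h) ` U) = card U"
proof -
  have "(\<lambda>u. h \<otimes> u \<otimes> inv h) ` U = h <# U #> inv h"
    by (auto simp: l_coset_def r_coset_def)
  then show "subgroup ((\<lambda>u. h \<otimes> u \<otimes> inv h) ` U) G"
    using subgroup_conjugation_is_surj2[OF h U] by simp
  have "inj_on (\<lambda>u. h \<otimes> u \<otimes> inv h) U"
    using h subgroup.mem_carrier[OF U] by (auto intro!: inj_onI)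
  then show "card ((\<lambda>u. h \<otimes> u \<otimes> inv h) ` U) = card U" by (rule card_image)
qed

lemma pow_card_subgroup:
  assumes U: "subgroup U G" and x: "x \<in> U"
  shows "x [^] card U = \<one>"
proof -
  interpret U: group "G\<lparr>carrier := U\<rparr>" using subgroup_imp_group[OF U] .
  have "x [^]\<^bsub>G\<lparr>carrier := U\<rparr>\<^esub> order (G\<lparr>carrier := U\<rparr>) = \<one>\<^bsub>G\<lparr>carrier := U\<rparr>\<^esub>"
    using U.pow_order_eq_1 x by simp
  then show ?thesis by (simp add: Coset.order_def nat_pow_consistent[symmetric])
qed

text \<open>Some conjugate \<open>V\<close> of a Sylow subgroup contains \<open>T\<close>. If
  \<open>T\<close> were smaller than \<open>V\<close>, its normalizer in \<open>V\<close> would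
  contain a \<open>p\<close>-element outside \<open>T\<close>, against \<open>nT\<close>.\<close>

lemma Sylow_criterion:
  assumes p: "Factorial_Ring.prime (p::nat)" and fin: "finite (carrier G)"
    and T: "subgroup T G" "card T = p ^ k"
    and nT: "\<And>x j. \<lbrakk>x \<in> carrier G; \<And>t. t \<in> T \<Longrightarrow> inv x \<otimes> t \<otimes> x \<in> T; x [^] (p ^ j :: nat) = \<one>\<rbrakk> \<Longrightarrow> x \<in> T"
  shows "\<not> p dvd order G div card T"
proof -
  have "order G > 0" using fin by (simp add: order_gt_0_iff_finite)
  then obtain a m where am: "order G = p ^ a * m" "\<not> p dvd m"
    using prime_power_canonical[OF p \<open>order G > 0\<close>] by (metis mult.commute)
  obtain U where U: "subgroup U G" "card U = p ^ a"
    using sylow_thm[OF _ is_group am(1) fin] p by blast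
  have pos: "p ^ a > 0" using p by (simp add: prime_gt_0_nat)
  have "\<not> p dvd order G div card U" using am U(2) pos by simp
  then obtain h where h: "h \<in> carrier G" "\<And>t. t \<in> T \<Longrightarrow> inv h \<otimes> t \<otimes> h \<in> U"
    using p_subgroup_conj_into_Sylow[OF p fin U(1) _ T] by blast
  define V where "V = (\<lambda>u. h \<otimes> u \<otimes> inv h) ` U"
  have V: "subgroup V G" "card V = p ^ a"
    unfolding V_def using conj_subgroup[OF U(1) h(1)] U(2) by auto
  have "T \<subseteq> V"
  proof
    fix t assume t: "t \<in> T"
    have tc: "t \<in> carrier G" using t subgroup.mem_carrier[OF T(1)] by blast
    have "t = h \<otimes> (inv h \<otimes> t \<otimes> h) \<otimes> inv h"
      using conjugation_is_surj[OF h(1) tc] by simp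
    then show "t \<in> V" unfolding V_def using h(2)[OF t] by blast
  qed
  moreover have "\<not> T \<subset> V"
  proof
    assume "T \<subset> V"
    then obtain x where x: "x \<in> V" "x \<notin> T" "\<And>t. t \<in> T \<Longrightarrow> inv x \<otimes> t \<otimes> x \<in> T"
      using proper_p_subgroup_normalizer_grows[OF p V T(1)] by blast
    have "x [^] (p ^ a) = \<one>" using pow_card_subgroup[OF V(1) x(1)] V(2) by simp
    then show False using nT[of x a] x subgroup.mem_carrier[OF V(1)] by blast
  qed
  ultimately have "T = V" by blast
  then show ?thesis using V(2) am pos by simp
qed

text \<open>The conjugate of \<open>S \<inter> K\<close> by \<open>h\<close> stays in
  \<open>K\<close>. Sylow conjugation inside \<open>K <#> S\<close> brings it back into
  \<open>S\<close> by an element whose \<open>K\<close>-part \<open>x\<close> suffices; then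
  \<open>y = inv x \<otimes> h\<close> normalizes \<open>S \<inter> K\<close>.\<close>

lemma Frattini_argument:
  assumes p: "Factorial_Ring.prime (p::nat)" and fin: "finite (carrier G)"
    and S: "subgroup S G" "card S = p ^ k" "\<not> p dvd order G div card S"
    and K: "K \<lhd> G" and h: "h \<in> carrier G"
  obtains x y where "x \<in> K" "y \<in> carrier G" "h = x \<otimes> y"
    "\<And>s. s \<in> S \<inter> K \<Longrightarrow> y \<otimes> s \<otimes> inv y \<in> S \<inter> K"
proof -
  have Ks: "subgroup K G" using K by (simp add: normal_imp_subgroup)
  define M where "M = K <#> S"
  have M: "subgroup M G" unfolding M_def by (rule mult_norm_subgroup[OF K S(1)])
  have SM: "S \<subseteq> M" unfolding M_def set_mult_def
    using subgroup.one_closed[OF Ks] subgroup.mem_carrier[OF S(1)] by force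
  have KM: "K \<subseteq> M" unfolding M_def set_mult_def
    using subgroup.one_closed[OF S(1)] subgroup.mem_carrier[OF Ks] by force
  interpret M: group "G\<lparr>carrier := M\<rparr>" using subgroup_imp_group[OF M] .
  have SM': "subgroup S (G\<lparr>carrier := M\<rparr>)" by (rule subgroup_of_subgroup[OF S(1) M SM])
  have "card S dvd card M" using M.card_subgroup_dvd[OF SM'] by (simp add: Coset.order_def)
  moreover have "card M dvd order G" by (rule card_subgroup_dvd[OF M])
  ultimately have "card M div card S dvd order G div card S"
    using div_dvd_div dvd_trans by blast
  \<comment> \<open>The index of \<open>S\<close> in \<open>M\<close> divides its index in the whole
    group, so \<open>S\<close> is a Sylow subgroup of \<open>M\<close> as well.\<close>
  then have nd: "\<not> p dvd order (G\<lparr>carrier := M\<rparr>) div card S"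
    using S(3) by (simp add: Coset.order_def) (meson dvd_trans)
  have SK: "subgroup (S \<inter> K) G" by (rule subgroups_Inter_pair[OF S(1) Ks])
  define T where "T = (\<lambda>u. h \<otimes> u \<otimes> inv h) ` (S \<inter> K)"
  have T: "subgroup T G" "card T = card (S \<inter> K)"
    unfolding T_def using conj_subgroup[OF SK h] by auto
  have TK: "T \<subseteq> K" unfolding T_def using normal_invE(2)[OF K h] by blast
  have "card (S \<inter> K) dvd p ^ k"
    using group.card_subgroup_dvd[OF subgroup_imp_group[OF S(1)] subgroup_of_subgroup[OF SK S(1)]] S(2)
    by (simp add: Coset.order_def)
  then obtain j where j: "card T = p ^ j" using divides_primepow_nat[OF p] T(2) by metis
  have finM: "finite M" using subgroup.subset[OF M] fin finite_subset by blast
  obtain g where g: "g \<in> M" "\<And>t. t \<in> T \<Longrightarrow> inv\<^bsub>G\<lparr>carrier := M\<rparr>\<^esub> g \<otimes> t \<otimes> g \<in> S"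
    using M.p_subgroup_conj_into_Sylow[OF p _ SM' nd subgroup_of_subgroup[OF T(1) M] j] TK KM finM
    by auto
  obtain x s where xs: "x \<in> K" "s \<in> S" "g = x \<otimes> s"
    using g(1) unfolding M_def set_mult_def by blast
  have xc: "x \<in> carrier G" and sc: "s \<in> carrier G"
    using xs subgroup.mem_carrier[OF Ks] subgroup.mem_carrier[OF S(1)] by auto
  show thesis
  proof (rule that[of x "inv x \<otimes> h"])
    show "x \<in> K" by fact
    show "inv x \<otimes> h \<in> carrier G" using xc h by simp
    show "h = x \<otimes> (inv x \<otimes> h)" using xc h by (simp add: m_assoc[symmetric])
  next
    fix u assume u: "u \<in> S \<inter> K"
    have uc: "u \<in> carrier G" using u subgroup.mem_carrier[OF Ks] by auto
    have ut: "h \<otimes> u \<otimes> inv h \<in> T" using u by (auto simp: T_def)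
    \<comment> \<open>As \<open>g = x \<otimes> s\<close> with \<open>s\<close> in \<open>S\<close>,
      conjugation by \<open>s\<close> can be undone within \<open>S\<close>; so conjugation by
      \<open>x\<close> alone already leads into \<open>S\<close>.\<close>
    define w where "w = inv x \<otimes> (h \<otimes> u \<otimes> inv h) \<otimes> x"
    have wc: "w \<in> carrier G" unfolding w_def using xc h uc by simp
    have "inv g \<otimes> (h \<otimes> u \<otimes> inv h) \<otimes> g \<in> S"
      using g ut m_inv_consistent[OF M] by metis
    moreover have "inv g \<otimes> (h \<otimes> u \<otimes> inv h) \<otimes> g = inv s \<otimes> w \<otimes> s"
      unfolding w_def xs(3) using xc sc h uc by (simp add: m_assoc inv_mult_group)
    ultimately have "s \<otimes> (inv s \<otimes> w \<otimes> s) \<otimes> inv s \<in> S"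
      using xs(2) S(1) by (simp add: subgroup.m_closed subgroup.m_inv_closed)
    moreover have "s \<otimes> (inv s \<otimes> w \<otimes> s) \<otimes> inv s = w"
      using sc wc conjugation_is_surj by (simp add: m_assoc)
    ultimately have "w \<in> S" by simp
    moreover have "w \<in> K"
      unfolding w_def using K xs(1) TK ut Ks
      by (metis subgroup.m_closed subgroup.m_inv_closed subsetD)
    moreover have "inv x \<otimes> h \<otimes> u \<otimes> inv (inv x \<otimes> h) = w"
      unfolding w_def using xc h uc by (simp add: m_assoc inv_mult_group)
    ultimately show "inv x \<otimes> h \<otimes> u \<otimes> inv (inv x \<otimes> h) \<in> S \<inter> K" by simp
  qed
qed

end

section \<open>Unipotent automorphisms of order \<open>p\<close>\<close>

text \<open>The prime divides the middle binomial coefficients. Degree 1 contributes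
  \<open>p y\<close>, and each degree from 2 to \<open>p - 1\<close> contributes \<open>p y\<close>
  times a multiple of \<open>y\<close>.\<close>

lemma prime_binomial_expansion:
  fixes y :: "'a :: comm_ring_1"
  assumes p: "Factorial_Ring.prime (p::nat)"
  obtains g where "(1 + y) ^ p = 1 + y ^ p + of_nat p * y * (1 + y * g)"
proof -
  have p2: "p \<ge> 2" using p by (rule prime_ge_2_nat)
  define c where "c k = (p choose k) div p" for k
  have c: "p choose k = p * c k" if "k \<in> {2..<p}" for k
    using that p by (auto simp: c_def intro!: dvd_mult_div_cancel[symmetric] dvd_choose_prime)
  have "(1 + y) ^ p = (y + 1) ^ p" by (simp add: add.commute)
  also have "\<dots> = (\<Sum>k\<le>p. of_nat (p choose k) * y ^ k)"
    by (simp add: binomial_ring)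
  also have "{..p} = insert 0 (insert 1 (insert p {2..<p}))" using p2 by auto
  also have "(\<Sum>k\<in>\<dots>. of_nat (p choose k) * y ^ k) =
      1 + of_nat p * y + y ^ p + (\<Sum>k\<in>{2..<p}. of_nat (p choose k) * y ^ k)"
    using p2 by simp
  also have "(\<Sum>k\<in>{2..<p}. of_nat (p choose k) * y ^ k) =
      (\<Sum>k\<in>{2..<p}. of_nat p * y * (y * (of_nat (c k) * y ^ (k - 2))))"
  proof (rule sum.cong[OF refl])
    fix k assume k: "k \<in> {2..<p}"
    then have "y ^ k = y * y * y ^ (k - 2)"
      by (metis add_diff_inverse_nat atLeastLessThan_iff not_less power2_eq_square power_add)
    then show "of_nat (p choose k) * y ^ k = of_nat p * y * (y * (of_nat (c k) * y ^ (k - 2)))"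
      using c[OF k] by (simp add: mult_ac)
  qed
  also have "\<dots> = of_nat p * y * (y * (\<Sum>k\<in>{2..<p}. of_nat (c k) * y ^ (k - 2)))"
    by (simp only: sum_distrib_left)
  finally show thesis
    by (intro that[of "\<Sum>k\<in>{2..<p}. of_nat (c k) * y ^ (k - 2)"]) (simp add: algebra_simps)
qed

text \<open>Modulo \<open>(1 + y) ^ p - 1\<close> the prime \<open>p\<close> times \<open>y\<close> behaves as for \<open>y = \<zeta> - 1\<close>,
  where \<open>p\<close> is an associate of \<open>y ^ (p - 1)\<close>.\<close>
lemma prime_mult_in_power_ideal:
  fixes y :: "'a :: comm_ring_1"
  assumes p: "Factorial_Ring.prime (p::nat)"
  obtains h t where "of_nat p * y = y ^ p * h + ((1 + y) ^ p - 1) * t"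
proof -
  obtain g where g: "(1 + y) ^ p = 1 + y ^ p + of_nat p * y * (1 + y * g)"
    using prime_binomial_expansion[OF p] .
  \<comment> \<open>The factor \<open>1 + y * g = 1 - z\<close> need not be invertible. Multiplying
    by the truncated geometric series \<open>t\<close> turns it into \<open>1 - z ^ (p - 1)\<close>,
    and the error \<open>y * z ^ (p - 1)\<close> is a multiple of \<open>y ^ p\<close>.\<close>
  define z where "z = - (y * g)"
  define t where "t = (\<Sum>i<p - 1. z ^ i)"
  have geo: "(1 - z) * t = 1 - z ^ (p - 1)"
    unfolding t_def by (simp add: one_diff_power_eq)
  have yz: "y * z ^ (p - 1) = y ^ p * (- g) ^ (p - 1)"
  proof -
    have "z = y * - g" by (simp add: z_def)
    then have "y * z ^ (p - 1) = y ^ Suc (p - 1) * (- g) ^ (p - 1)"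
      by (simp only: power_mult_distrib power_Suc mult.assoc)
    then show ?thesis using prime_gt_0_nat[OF p] by simp
  qed
  have "((1 + y) ^ p - 1) * t = y ^ p * t + of_nat p * y * ((1 - z) * t)"
    unfolding g z_def by (simp add: algebra_simps)
  also have "\<dots> = y ^ p * t + of_nat p * y - of_nat p * (y * z ^ (p - 1))"
    unfolding geo by (simp add: algebra_simps)
  finally have "of_nat p * y = y ^ p * (of_nat p * (- g) ^ (p - 1) - t) + ((1 + y) ^ p - 1) * t"
    unfolding yz by (simp add: algebra_simps)
  then show thesis by (rule that)
qed

text \<open>Each further factor \<open>p\<close> turns one \<open>y\<close> into a multiple of
  \<open>y ^ p\<close> modulo \<open>(1 + y) ^ p - 1\<close>, raising the exponent by
  \<open>p - 1\<close>. This yields exactly the exponent that occurs in the bound on the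
  class.\<close>

lemma prime_power_mult_in_power_ideal:
  fixes y :: "'a :: comm_ring_1"
  assumes p: "Factorial_Ring.prime (p::nat)"
  shows "\<exists>a b. of_nat (p ^ n) * y = a * y ^ (n * (p - 1) + 1) + b * ((1 + y) ^ p - 1)"
proof (induction n)
  case 0
  show ?case by (rule exI[of _ 1], rule exI[of _ 0]) simp
next
  case (Suc n)
  then obtain a b where ab: "of_nat (p ^ n) * y = a * y ^ (n * (p - 1) + 1) + b * ((1 + y) ^ p - 1)"
    by blast
  obtain h t where ht: "of_nat p * y = y ^ p * h + ((1 + y) ^ p - 1) * t"
    using prime_mult_in_power_ideal[OF p] .
  define x where "x = (1 + y) ^ p - 1"
  have e: "y ^ (n * (p - 1)) * y ^ p = y ^ (Suc n * (p - 1) + 1)"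
    using prime_gt_0_nat[OF p] by (simp add: power_add[symmetric] add.commute)
  have "of_nat (p ^ Suc n) * y = of_nat p * (of_nat (p ^ n) * y)" by (simp add: mult_ac)
  also have "\<dots> = a * y ^ (n * (p - 1)) * (of_nat p * y) + of_nat p * b * x"
    unfolding ab x_def[symmetric] by (simp add: algebra_simps)
  also have "\<dots> = a * h * (y ^ (n * (p - 1)) * y ^ p) + (a * y ^ (n * (p - 1)) * t + of_nat p * b) * x"
    unfolding ht x_def[symmetric] by (simp add: algebra_simps)
  finally show ?case unfolding e x_def by blast
qed

text \<open>Horner's scheme for \<open>f(\<sigma>)\<close> applied to \<open>v\<close>, in
  multiplicative notation. It makes an abelian group a module over the integer polynomials, with the
  indeterminate acting as \<open>\<sigma>\<close>.\<close>

definition poly_act :: "('a, 'b) monoid_scheme \<Rightarrow> ('a \<Rightarrow> 'a) \<Rightarrow> int poly \<Rightarrow> 'a \<Rightarrow> 'a" where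
  "poly_act A \<sigma> f v = foldr (\<lambda>a w. v [^]\<^bsub>A\<^esub> a \<otimes>\<^bsub>A\<^esub> \<sigma> w) (coeffs f) \<one>\<^bsub>A\<^esub>"

locale comm_group_endo = comm_group A for A (structure) +
  fixes \<sigma> :: "'a \<Rightarrow> 'a"
  assumes endo: "\<sigma> \<in> hom A A"
begin

sublocale \<sigma>: group_hom A A \<sigma>
  by unfold_locales (rule endo)

abbreviation act :: "int poly \<Rightarrow> 'a \<Rightarrow> 'a" where "act \<equiv> poly_act A \<sigma>"

lemma act_0 [simp]: "act 0 v = \<one>"
  by (simp add: poly_act_def)

lemma act_pCons [simp]: "v \<in> carrier A \<Longrightarrow> act (pCons a f) v = v [^] a \<otimes> \<sigma> (act f v)"
  by (auto simp: poly_act_def cCons_def)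

lemma act_closed [simp]: "v \<in> carrier A \<Longrightarrow> act f v \<in> carrier A"
  by (induction f) auto

lemma act_one [simp]: "act f \<one> = \<one>"
  by (induction f) auto

lemma act_add: "v \<in> carrier A \<Longrightarrow> act (f + g) v = act f v \<otimes> act g v"
  by (induction f g rule: poly_induct2) (auto simp: int_pow_mult m_ac)

lemma act_smult: "v \<in> carrier A \<Longrightarrow> act (Polynomial.smult c f) v = act f v [^] c"
  by (induction f) (auto simp: int_pow_distrib int_pow_pow \<sigma>.hom_int_pow mult.commute)

lemma act_mult: "v \<in> carrier A \<Longrightarrow> act (f * g) v = act f (act g v)"
  by (induction f) (auto simp: act_add act_smult)

lemma act_power: "v \<in> carrier A \<Longrightarrow> act (f ^ k) v = (act f ^^ k) v"
proof (induction k)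
  case 0
  then show ?case by (simp add: one_pCons)
qed (simp add: act_mult)

lemma funpow_closed: "v \<in> carrier A \<Longrightarrow> (\<sigma> ^^ k) v \<in> carrier A"
  by (induction k) auto

lemma act_of_nat: "v \<in> carrier A \<Longrightarrow> act (of_nat k) v = v [^] k"
  by (simp add: of_nat_poly int_pow_int)

text \<open>Let \<open>y\<close> be the indeterminate minus 1. In the identity for
  \<open>p ^ n * y\<close> both terms on the right annihilate \<open>v\<close>: one by the vanishing
  iterated commutator, the other because \<open>\<sigma>\<close> has period \<open>p\<close>. What
  remains is \<open>(\<sigma> - 1) (p ^ n v) = 0\<close>.\<close>

lemma unipotent_fixes_prime_power:
  assumes p: "Factorial_Ring.prime (p::nat)"
    and per: "\<And>v. v \<in> carrier A \<Longrightarrow> (\<sigma> ^^ p) v = v"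
    and nil: "\<And>v. v \<in> carrier A \<Longrightarrow> ((\<lambda>v. inv v \<otimes> \<sigma> v) ^^ (n * (p - 1) + 1)) v = \<one>"
    and v: "v \<in> carrier A"
  shows "\<sigma> (v [^] (p ^ n)) = v [^] (p ^ n)"
proof -
  define y :: "int poly" where "y = [:- 1, 1:]"
  have y: "act y v = inv v \<otimes> \<sigma> v" if "v \<in> carrier A" for v
    using that by (simp add: y_def int_pow_neg)
  \<comment> \<open>The action of \<open>y\<close> and the commutator map agree on the carrier only,
    so membership is carried through the induction.\<close>
  have D: "(act y ^^ k) v = ((\<lambda>v. inv v \<otimes> \<sigma> v) ^^ k) v \<and> (act y ^^ k) v \<in> carrier A"
    if "v \<in> carrier A" for k v
    using that by (induction k) (auto simp: y)
  have x: "1 + y = [:0, 1:]" by (simp add: y_def one_pCons)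
  have "(act [:0, 1:] ^^ k) v = (\<sigma> ^^ k) v" for k
    using v by (induction k) (auto simp: funpow_closed)
  then have xp: "act ([:0, 1:] ^ p) v = v" using v per by (simp add: act_power)
  have xp1: "act ((1 + y) ^ p - 1) v = \<one>"
  proof -
    have "(1 + y) ^ p - 1 = [:0, 1:] ^ p + [:- 1:]"
      unfolding x diff_conv_add_uminus by (simp add: one_pCons)
    then show ?thesis using act_add[OF v, of "[:0, 1:] ^ p" "[:- 1:]"] v xp
      by (simp add: int_pow_neg)
  qed
  obtain a b where ab: "of_nat (p ^ n) * y = a * y ^ (n * (p - 1) + 1) + b * ((1 + y) ^ p - 1)"
    using prime_power_mult_in_power_ideal[OF p, of n y] by blast
  \<comment> \<open>The factors are ordered so that the power of \<open>v\<close> is taken first and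
    the commutator map is applied to it.\<close>
  have "act (y * of_nat (p ^ n)) v = act (a * y ^ (n * (p - 1) + 1)) v \<otimes> act (b * ((1 + y) ^ p - 1)) v"
    by (simp only: act_add[OF v, symmetric] ab[symmetric] mult.commute[of y])
  also have "act (b * ((1 + y) ^ p - 1)) v = \<one>" using v xp1 by (simp add: act_mult)
  also have "act (a * y ^ (n * (p - 1) + 1)) v = act a ((act y ^^ (n * (p - 1) + 1)) v)"
    using v by (simp only: act_mult act_power)
  also have "(act y ^^ (n * (p - 1) + 1)) v = \<one>" using D[OF v] nil[OF v] by metis
  finally have "inv (v [^] (p ^ n)) \<otimes> \<sigma> (v [^] (p ^ n)) = \<one>"
    using v by (simp add: act_mult act_of_nat y del: of_nat_power)
  then show ?thesis using v by (simp add: inv_solve_left' r_one)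
qed

end

section \<open>Conjugation and the lower central series\<close>

context group
begin

lemma conjm_closed [simp]: "\<lbrakk>x \<in> carrier G; z \<in> carrier G\<rbrakk> \<Longrightarrow> conjm G x z \<in> carrier G"
  by (simp add: conjm_def)

lemma conjm_mult:
  assumes "x \<in> carrier G" "z \<in> carrier G" "w \<in> carrier G"
  shows "conjm G x (z \<otimes> w) = conjm G x z \<otimes> conjm G x w"
proof -
  have "inv x \<otimes> (x \<otimes> (w \<otimes> inv x)) = w \<otimes> inv x"
    using assms by (simp add: m_assoc[symmetric])
  then show ?thesis using assms by (simp add: conjm_def m_assoc)
qed

lemma conjm_comp:
  "\<lbrakk>x \<in> carrier G; y \<in> carrier G; z \<in> carrier G\<rbrakk> \<Longrightarrow> conjm G (x \<otimes> y) z = conjm G x (conjm G y z)"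
  by (simp add: conjm_def m_assoc inv_mult_group)

lemma conjm_one [simp]: "z \<in> carrier G \<Longrightarrow> conjm G \<one> z = z"
  by (simp add: conjm_def)

lemma conjm_eq_iff_commute:
  assumes "x \<in> carrier G" "z \<in> carrier G"
  shows "conjm G x z = z \<longleftrightarrow> x \<otimes> z = z \<otimes> x"
  unfolding conjm_def using assms by (simp add: inv_solve_right')

lemma lower_central_subgroup: "subgroup (lower_central G i) G"
proof (induction i)
  case 0
  show ?case by (simp add: subgroup_self)
next
  case (Suc i)
  then show ?case
    by (auto simp: comm_subgroup_def subgroup.mem_carrier intro!: generate_is_subgroup)
qed

lemma commutator_in_lower_central:
  assumes v: "v \<in> lower_central G i" and x: "x \<in> carrier G"
  shows "inv v \<otimes> conjm G x v \<in> lower_central G (Suc i)"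
proof -
  have vc: "v \<in> carrier G" by (rule subgroup.mem_carrier[OF lower_central_subgroup v])
  \<comment> \<open>This is the commutator \<open>a b inv a inv b\<close> with
    \<open>a = inv v\<close> and \<open>b = x\<close>.\<close>
  have "inv v \<otimes> conjm G x v = inv v \<otimes> x \<otimes> inv (inv v) \<otimes> inv x"
    using vc x by (simp add: conjm_def m_assoc)
  moreover have "inv v \<in> lower_central G i"
    by (rule subgroup.m_inv_closed[OF lower_central_subgroup v])
  ultimately show ?thesis
    using x by (auto simp: comm_subgroup_def intro!: generate.incl)
qed

text \<open>Conjugation by \<open>x\<close> is a unipotent endomorphism of \<open>V\<close> of order dividing \<open>p\<close>.\<close>
lemma nilpotent_conj_fixes_prime_power:
  assumes p: "Factorial_Ring.prime (p::nat)" and nil: "nilpotent_class_le G (n * (p - 1) + 1)"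
    and V: "subgroup V G" and comm: "\<And>v w. \<lbrakk>v \<in> V; w \<in> V\<rbrakk> \<Longrightarrow> v \<otimes> w = w \<otimes> v"
    and x: "x \<in> carrier G" and xV: "conjm G x ` V \<subseteq> V"
    and xp: "\<And>v. v \<in> V \<Longrightarrow> conjm G (x [^] p) v = v"
    and v: "v \<in> V"
  shows "conjm G x (v [^] (p ^ n)) = v [^] (p ^ n)"
proof -
  let ?A = "G\<lparr>carrier := V\<rparr>"
  interpret A: group ?A using subgroup_imp_group[OF V] .
  have Vc: "w \<in> carrier G" if "w \<in> V" for w by (rule subgroup.mem_carrier[OF V that])
  interpret comm_group_endo ?A "conjm G x"
  proof (intro comm_group_endo.intro comm_group_endo_axioms.intro A.group_comm_groupI homI)
    show "a \<otimes>\<^bsub>?A\<^esub> b = b \<otimes>\<^bsub>?A\<^esub> a" if "a \<in> carrier ?A" "b \<in> carrier ?A" for a b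
      using that comm by simp
    show "conjm G x a \<in> carrier ?A" if "a \<in> carrier ?A" for a
      using that xV by auto
    show "conjm G x (a \<otimes>\<^bsub>?A\<^esub> b) = conjm G x a \<otimes>\<^bsub>?A\<^esub> conjm G x b"
      if "a \<in> carrier ?A" "b \<in> carrier ?A" for a b
      using that Vc x by (simp add: conjm_mult)
  qed
  have "conjm G (x [^] k) w = (conjm G x ^^ k) w" if "w \<in> V" for k :: nat and w
  proof (induction k)
    case 0
    then show ?case using Vc[OF that] by (simp add: conjm_def)
  next
    case (Suc k)
    have "x [^] Suc k = x \<otimes> x [^] k" using x by (rule nat_pow_Suc2)
    then show ?case using Suc[symmetric] Vc[OF that] x
      by (simp add: conjm_comp del: nat_pow_Suc)
  qed
  then have per: "(conjm G x ^^ p) w = w" if "w \<in> V" for w using xp that by metis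
  \<comment> \<open>Each commutator with \<open>x\<close> descends one step in the lower central
    series. The series starts at index 0 with the whole group, so \<open>n * (p - 1) + 1\<close>
    commutators reach the trivial term.\<close>
  have D: "((\<lambda>v. inv\<^bsub>?A\<^esub> v \<otimes>\<^bsub>?A\<^esub> conjm G x v) ^^ k) w \<in> V \<inter> lower_central G k"
    if "w \<in> V" for k w
  proof (induction k)
    case 0
    then show ?case using that Vc by simp
  next
    case (Suc k)
    define u where "u = ((\<lambda>v. inv\<^bsub>?A\<^esub> v \<otimes>\<^bsub>?A\<^esub> conjm G x v) ^^ k) w"
    have u: "u \<in> V" "u \<in> lower_central G k" using Suc by (auto simp: u_def)
    have "inv u \<otimes> conjm G x u \<in> lower_central G (Suc k)"
      by (rule commutator_in_lower_central[OF u(2) x])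
    moreover have "inv u \<otimes> conjm G x u \<in> V"
      using u(1) xV V by (meson image_subset_iff subgroup.m_closed subgroup.m_inv_closed)
    ultimately show ?case
      unfolding funpow.simps o_apply u_def[symmetric]
      using m_inv_consistent[OF V u(1)] by (simp del: lower_central.simps)
  qed
  have "((\<lambda>v. inv\<^bsub>?A\<^esub> v \<otimes>\<^bsub>?A\<^esub> conjm G x v) ^^ (n * (p - 1) + 1)) w = \<one>\<^bsub>?A\<^esub>"
    if "w \<in> carrier ?A" for w
    using D[of w "n * (p - 1) + 1"] that nil unfolding nilpotent_class_le_def by auto
  then have "conjm G x (v [^]\<^bsub>?A\<^esub> (p ^ n)) = v [^]\<^bsub>?A\<^esub> (p ^ n)"
    using unipotent_fixes_prime_power[OF p, of n v] per v by simp
  then show ?thesis by (simp add: nat_pow_consistent[symmetric])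
qed

end

section \<open>Saturated fusion systems\<close>

text \<open>The image is isomorphic to the quotient by the kernel, so its order divides
  \<open>p ^ k\<close>.\<close>

lemma (in group_hom) p_group_image:
  assumes p: "Factorial_Ring.prime (p::nat)" and ord: "order G = p ^ k"
  shows "subgroup (h ` carrier G) H" "\<exists>j. card (h ` carrier G) = p ^ j"
proof -
  show "subgroup (h ` carrier G) H" by (rule img_is_subgroup)
  let ?I = "H\<lparr>carrier := h ` carrier G\<rparr>"
  have "group_hom G ?I h"
    by (intro group_hom.intro group_hom_axioms.intro homI G.is_group
        H.subgroup_imp_group[OF img_is_subgroup]) auto
  then have "(\<lambda>C. the_elem (h ` C)) \<in> iso (G Mod kernel G ?I h) ?I"
    by (rule group_hom.FactGroup_iso_set) simp
  then have "bij_betw (\<lambda>C. the_elem (h ` C)) (carrier (G Mod kernel G H h)) (h ` carrier G)"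
    by (simp add: iso_def kernel_def)
  then have "card (rcosets (kernel G H h)) = card (h ` carrier G)"
    by (simp add: bij_betw_same_card FactGroup_def)
  then have "card (h ` carrier G) dvd p ^ k"
    using G.lagrange[OF subgroup_kernel] ord by (metis dvd_triv_left)
  then show "\<exists>j. card (h ` carrier G) = p ^ j" using divides_primepow_nat[OF p] by blast
qed

section \<open>Normalizers of subgroups, in particular in \<open>p\<close>-groups\<close>

context group
begin

lemma conjm_inv_conjm [simp]:
  "\<lbrakk>x \<in> carrier G; z \<in> carrier G\<rbrakk> \<Longrightarrow> conjm G (inv x) (conjm G x z) = z"
  "\<lbrakk>x \<in> carrier G; z \<in> carrier G\<rbrakk> \<Longrightarrow> conjm G x (conjm G (inv x) z) = z"
  by (simp_all add: conjm_comp[symmetric])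

lemma normalizer_in_subgroup:
  assumes Q: "Q \<subseteq> carrier G"
  shows "subgroup (normalizer_in G Q) G"
proof (rule subgroupI)
  show "normalizer_in G Q \<subseteq> carrier G" by (auto simp: normalizer_in_def)
  have "conjm G \<one> ` Q = Q" using Q by (force simp: image_iff)
  then show "normalizer_in G Q \<noteq> {}" by (auto simp: normalizer_in_def)
next
  fix a assume "a \<in> normalizer_in G Q"
  then have a: "a \<in> carrier G" "conjm G a ` Q = Q" by (auto simp: normalizer_in_def)
  have "conjm G (inv a) ` Q = conjm G (inv a) ` (conjm G a ` Q)" using a(2) by simp
  also have "\<dots> = Q" unfolding image_image using Q a(1) by (force simp: image_iff)
  finally show "inv a \<in> normalizer_in G Q" using a(1) by (simp add: normalizer_in_def)
next
  fix a b assume "a \<in> normalizer_in G Q" "b \<in> normalizer_in G Q"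
  then have ab: "a \<in> carrier G" "conjm G a ` Q = Q" "b \<in> carrier G" "conjm G b ` Q = Q"
    by (auto simp: normalizer_in_def)
  have "conjm G (a \<otimes> b) ` Q = conjm G a ` conjm G b ` Q"
    unfolding image_image using Q ab by (intro image_cong) (auto simp: conjm_comp)
  then show "a \<otimes> b \<in> normalizer_in G Q" using ab by (simp add: normalizer_in_def)
qed

lemma conjm_in_subgroup:
  "\<lbrakk>subgroup Q G; x \<in> Q; z \<in> Q\<rbrakk> \<Longrightarrow> conjm G x z \<in> Q"
  by (simp add: conjm_def subgroup.m_closed subgroup.m_inv_closed)

lemma normalizer_inI:
  assumes Q: "subgroup Q G" and x: "x \<in> carrier G" and fin: "finite Q"
    and sub: "conjm G x ` Q \<subseteq> Q"
  shows "x \<in> normalizer_in G Q"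
proof -
  have "inj_on (conjm G x) Q"
    by (rule inj_on_inverseI[where g = "conjm G (inv x)"]) (use x subgroup.mem_carrier[OF Q] in auto)
  then have "conjm G x ` Q = Q" using endo_inj_surj[OF fin sub] by blast
  then show ?thesis using x by (simp add: normalizer_in_def)
qed

lemma subgroup_le_normalizer_in:
  assumes Q: "subgroup Q G" and fin: "finite Q"
  shows "Q \<subseteq> normalizer_in G Q"
  using normalizer_inI[OF Q subgroup.mem_carrier[OF Q] fin] conjm_in_subgroup[OF Q] by blast

lemma proper_subgroup_of_normalizer_in:
  assumes pg: "p_group p G" and p: "Factorial_Ring.prime (p::nat)"
    and Q: "subgroup Q G" "Q \<noteq> carrier G"
  shows "Q \<subset> normalizer_in G Q"
proof -
  obtain k where k: "finite (carrier G)" "card (carrier G) = p ^ k"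
    using pg by (auto simp: p_group_def)
  have finQ: "finite Q" using subgroup.subset[OF Q(1)] k(1) finite_subset by blast
  have "Q \<subset> carrier G" using Q subgroup.subset[OF Q(1)] by blast
  then obtain x where x: "x \<in> carrier G" "x \<notin> Q" "\<And>t. t \<in> Q \<Longrightarrow> inv x \<otimes> t \<otimes> x \<in> Q"
    using proper_p_subgroup_normalizer_grows[OF p subgroup_self k(2) Q(1)] by blast
  have "inv x \<in> normalizer_in G Q"
    by (rule normalizer_inI[OF Q(1) _ finQ]) (use x in \<open>auto simp: conjm_def\<close>)
  then have "x \<in> normalizer_in G Q"
    using normalizer_in_subgroup[OF subgroup.subset[OF Q(1)]] x(1)
    by (metis inv_inv subgroup.m_inv_closed)
  then show ?thesis using x(2) subgroup_le_normalizer_in[OF Q(1) finQ] by blast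
qed

end

text \<open>Composition is truncated to \<open>Q\<close> by \<open>compose Q\<close>, and the unit
  is a restricted identity, because morphisms are represented by extensional functions.\<close>

definition AutF :: "'a homs \<Rightarrow> 'a set \<Rightarrow> ('a \<Rightarrow> 'a) monoid" where
  "AutF Hom Q = \<lparr>carrier = Hom Q Q, monoid.mult = \<lambda>f g. compose Q f g, monoid.one = restrict id Q\<rparr>"

definition AutP :: "('a, 'b) monoid_scheme \<Rightarrow> 'a set \<Rightarrow> ('a \<Rightarrow> 'a) set" where
  "AutP P Q = (\<lambda>x. restrict (conjm P x) Q) ` normalizer_in P Q"

section \<open>Elementary properties of morphisms\<close>

locale saturated_fusion = group P for P (structure) +
  fixes Hom :: "'a homs" and p :: nat
  assumes prime_p: "Factorial_Ring.prime p" and p_grp: "p_group p P"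
    and sat: "saturated_fusion_system p P Hom"
begin

abbreviation N :: "'a set \<Rightarrow> 'a set" where "N \<equiv> normalizer_in P"

lemma finP: "finite (carrier P)"
  using p_grp by (simp add: p_group_def)

lemma fin_subgroup: "subgroup Q P \<Longrightarrow> finite Q"
  using finP subgroup.subset finite_subset by metis

lemma cat: "fusion_category P Hom"
  using sat by (simp add: saturated_fusion_system_def)

lemma HomD:
  assumes "\<phi> \<in> Hom Q R"
  shows "subgroup Q P" "subgroup R P" "\<phi> \<in> extensional Q" "inj_on \<phi> Q" "\<phi> ` Q \<subseteq> R"
    "\<And>a b. \<lbrakk>a \<in> Q; b \<in> Q\<rbrakk> \<Longrightarrow> \<phi> (a \<otimes> b) = \<phi> a \<otimes> \<phi> b"
proof -
  have "subgroup Q P \<and> subgroup R P" using cat assms unfolding fusion_category_def by blast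
  then show "subgroup Q P" "subgroup R P" by auto
  have "\<phi> \<in> inj_homs P Q R" using cat assms unfolding fusion_category_def by blast
  then show "\<phi> \<in> extensional Q" "inj_on \<phi> Q" "\<phi> ` Q \<subseteq> R"
    "\<And>a b. \<lbrakk>a \<in> Q; b \<in> Q\<rbrakk> \<Longrightarrow> \<phi> (a \<otimes> b) = \<phi> a \<otimes> \<phi> b"
    by (auto simp: inj_homs_def)
qed

lemma Hom_carrier:
  assumes "\<phi> \<in> Hom Q R" "z \<in> Q"
  shows "\<phi> z \<in> R" "\<phi> z \<in> carrier P" "z \<in> carrier P"
  using assms(2) HomD(5)[OF assms(1)] subgroup.mem_carrier[OF HomD(1)[OF assms(1)]]
    subgroup.mem_carrier[OF HomD(2)[OF assms(1)]] by auto

lemma Hom_group_hom: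
  assumes "\<phi> \<in> Hom Q R"
  shows "group_hom (P\<lparr>carrier := Q\<rparr>) P \<phi>"
proof (intro group_hom.intro group_hom_axioms.intro homI)
  show "group (P\<lparr>carrier := Q\<rparr>)" by (rule subgroup_imp_group[OF HomD(1)[OF assms]])
qed (use Hom_carrier[OF assms] HomD(6)[OF assms] in \<open>auto intro: is_group\<close>)

lemma Hom_image_subgroup:
  assumes "\<phi> \<in> Hom Q R" "subgroup U P" "U \<subseteq> Q"
  shows "subgroup (\<phi> ` U) P"
  using group_hom.subgroup_img_is_subgroup[OF Hom_group_hom[OF assms(1)]]
    subgroup_of_subgroup[OF assms(2) HomD(1)[OF assms(1)] assms(3)] by blast

lemma Hom_inv:
  assumes "\<phi> \<in> Hom Q R" "z \<in> Q"
  shows "\<phi> (inv z) = inv (\<phi> z)"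
  using group_hom.hom_inv[OF Hom_group_hom[OF assms(1)], of z] assms
    m_inv_consistent[OF HomD(1)[OF assms(1)]] by simp

lemma Hom_conjm:
  assumes "\<phi> \<in> Hom Q R" "x \<in> Q" "z \<in> Q"
  shows "\<phi> (conjm P x z) = conjm P (\<phi> x) (\<phi> z)"
  using assms HomD(1)[OF assms(1)] HomD(6)[OF assms(1)] Hom_inv[OF assms(1)]
  by (simp add: conjm_def subgroup.m_closed subgroup.m_inv_closed)

lemma Hom_nat_pow:
  assumes "\<phi> \<in> Hom Q R" "z \<in> Q"
  shows "\<phi> (z [^] (k::nat)) = \<phi> z [^] k"
  using group_hom.hom_nat_pow[OF Hom_group_hom[OF assms(1)], of z k] assms
  by (simp add: nat_pow_consistent[symmetric])

lemma Hom_compose: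
  assumes "\<phi> \<in> Hom Q R" "\<psi> \<in> Hom R S"
  shows "compose Q \<psi> \<phi> \<in> Hom Q S"
proof -
  have "restrict (\<psi> \<circ> \<phi>) Q \<in> Hom Q S" using cat assms unfolding fusion_category_def by blast
  then show ?thesis by (simp add: compose_def comp_def)
qed

lemma conj_Hom:
  assumes "subgroup Q P" "subgroup R P" "x \<in> carrier P" "conjm P x ` Q \<subseteq> R"
  shows "restrict (conjm P x) Q \<in> Hom Q R"
  using sat assms unfolding saturated_fusion_system_def by blast

text \<open>An inclusion is conjugation by \<open>\<one>\<close>, so it is among the morphisms
  induced by \<open>P\<close>.\<close>

lemma incl_Hom:
  assumes "subgroup Q P" "subgroup R P" "Q \<subseteq> R"
  shows "restrict id Q \<in> Hom Q R"
proof -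
  have e: "conjm P \<one> z = z" if "z \<in> Q" for z
    using subgroup.mem_carrier[OF assms(1) that] by simp
  then have "restrict (conjm P \<one>) Q \<in> Hom Q R"
    using assms by (intro conj_Hom) auto
  moreover have "restrict (conjm P \<one>) Q = restrict id Q"
    using e by (intro restrict_ext) simp
  ultimately show ?thesis by simp
qed

lemma Hom_restrict:
  assumes "\<phi> \<in> Hom Q R" "subgroup U P" "U \<subseteq> Q"
  shows "restrict \<phi> U \<in> Hom U R"
proof -
  have "compose U \<phi> (restrict id U) \<in> Hom U R"
    by (rule Hom_compose[OF incl_Hom[OF assms(2) HomD(1)[OF assms(1)] assms(3)] assms(1)])
  moreover have "compose U \<phi> (restrict id U) = restrict \<phi> U"
    unfolding compose_def by (intro restrict_ext) simp
  ultimately show ?thesis by simp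
qed

text \<open>A morphism factors through its image; the codomain is changed by following it with
  another inclusion of that image.\<close>

lemma Hom_codomain:
  assumes \<phi>: "\<phi> \<in> Hom Q R" and "\<phi> ` Q \<subseteq> S" "subgroup S P"
  shows "\<phi> \<in> Hom Q S"
proof -
  have 1: "\<phi> \<in> Hom Q (\<phi> ` Q)" using cat \<phi> unfolding fusion_category_def by blast
  have "compose Q (restrict id (\<phi> ` Q)) \<phi> \<in> Hom Q S"
    by (rule Hom_compose[OF 1 incl_Hom[OF HomD(2)[OF 1] assms(3,2)]])
  moreover have "compose Q (restrict id (\<phi> ` Q)) \<phi> = \<phi>"
    using HomD(3)[OF \<phi>] by (intro extensionalityI[of _ Q]) (auto simp: compose_def)
  ultimately show ?thesis by simp
qed

lemma Hom_carrierI: "\<phi> \<in> Hom Q R \<Longrightarrow> \<phi> \<in> Hom Q (carrier P)"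
  using Hom_codomain[of \<phi> Q R "carrier P"] Hom_carrier(2)[of \<phi> Q R] subgroup_self by blast

lemma Hom_inverse:
  assumes "\<phi> \<in> Hom Q R" "\<phi> ` Q = S"
  shows "restrict (inv_into Q \<phi>) S \<in> Hom S Q"
  using cat assms unfolding fusion_category_def by blast

lemma Hom_Aut_image:
  assumes "\<phi> \<in> Hom Q Q" shows "\<phi> ` Q = Q"
  using endo_inj_surj[OF fin_subgroup[OF HomD(1)] HomD(5) HomD(4)] assms by blast

section \<open>Automorphism groups and the \<open>p\<close>-subgroups induced by normalizers\<close>

lemma carrier_AutF [simp]: "carrier (AutF Hom Q) = Hom Q Q"
  by (simp add: AutF_def)

lemma mult_AutF [simp]: "z \<in> Q \<Longrightarrow> (f \<otimes>\<^bsub>AutF Hom Q\<^esub> g) z = f (g z)"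
  by (simp add: AutF_def compose_def)

lemma one_AutF [simp]: "z \<in> Q \<Longrightarrow> \<one>\<^bsub>AutF Hom Q\<^esub> z = z"
  by (simp add: AutF_def)

lemma Hom_eqI:
  assumes "\<phi> \<in> Hom Q R" "\<psi> \<in> Hom Q S" "\<And>z. z \<in> Q \<Longrightarrow> \<phi> z = \<psi> z"
  shows "\<phi> = \<psi>"
  using extensionalityI[OF HomD(3)[OF assms(1)] HomD(3)[OF assms(2)] assms(3)] .

lemma AutF_group:
  assumes Q: "subgroup Q P"
  shows "group (AutF Hom Q)"
proof (rule groupI)
  fix f g h assume f: "f \<in> carrier (AutF Hom Q)" and g: "g \<in> carrier (AutF Hom Q)"
    and h: "h \<in> carrier (AutF Hom Q)"
  show "f \<otimes>\<^bsub>AutF Hom Q\<^esub> g \<otimes>\<^bsub>AutF Hom Q\<^esub> h = f \<otimes>\<^bsub>AutF Hom Q\<^esub> (g \<otimes>\<^bsub>AutF Hom Q\<^esub> h)"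
    using h Hom_carrier(1)[of h Q Q] by (auto simp: AutF_def compose_def intro!: restrict_ext)
next
  fix f assume f: "f \<in> carrier (AutF Hom Q)"
  then have f': "f \<in> Hom Q Q" by simp
  show "\<one>\<^bsub>AutF Hom Q\<^esub> \<otimes>\<^bsub>AutF Hom Q\<^esub> f = f"
    using HomD(3)[OF f'] Hom_carrier(1)[OF f']
    by (intro extensionalityI[of _ Q]) (auto simp: AutF_def compose_def)
  show "\<exists>g\<in>carrier (AutF Hom Q). g \<otimes>\<^bsub>AutF Hom Q\<^esub> f = \<one>\<^bsub>AutF Hom Q\<^esub>"
  proof (rule bexI)
    show "restrict (inv_into Q f) Q \<in> carrier (AutF Hom Q)"
      using Hom_inverse[OF f' Hom_Aut_image[OF f']] by simp
    show "restrict (inv_into Q f) Q \<otimes>\<^bsub>AutF Hom Q\<^esub> f = \<one>\<^bsub>AutF Hom Q\<^esub>"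
      using HomD(4)[OF f'] Hom_carrier(1)[OF f']
      by (auto simp: AutF_def compose_def intro!: restrict_ext)
  qed
qed (use Hom_compose incl_Hom[OF Q Q] in \<open>auto simp: AutF_def\<close>)

lemma finite_AutF: "finite (Hom Q Q)"
proof (cases "subgroup Q P")
  case True
  have "Hom Q Q \<subseteq> (\<Pi>\<^sub>E z\<in>Q. Q)"
  proof
    fix f assume f: "f \<in> Hom Q Q"
    show "f \<in> (\<Pi>\<^sub>E z\<in>Q. Q)" using HomD(3,5)[OF f] by (auto simp: PiE_def)
  qed
  moreover have "finite (\<Pi>\<^sub>E z\<in>Q. Q)" using fin_subgroup[OF True] by (simp add: finite_PiE)
  ultimately show ?thesis by (rule finite_subset)
next
  case False
  then have "Hom Q Q = {}" using HomD(1) by blast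
  then show ?thesis by simp
qed

lemma N_subgroup: "subgroup Q P \<Longrightarrow> subgroup (N Q) P"
  by (rule normalizer_in_subgroup[OF subgroup.subset])

lemma N_D: "x \<in> N Q \<Longrightarrow> x \<in> carrier P" "x \<in> N Q \<Longrightarrow> conjm P x ` Q = Q"
  by (auto simp: normalizer_in_def)

lemma conj_AutF:
  assumes "subgroup Q P" "x \<in> N Q"
  shows "restrict (conjm P x) Q \<in> Hom Q Q"
  using conj_Hom[OF assms(1,1) N_D(1)[OF assms(2)]] N_D(2)[OF assms(2)] by simp

lemma card_subgroup_p_power: "subgroup U P \<Longrightarrow> \<exists>k. card U = p ^ k"
proof -
  assume U: "subgroup U P"
  obtain k where "card (carrier P) = p ^ k" using p_grp by (auto simp: p_group_def)
  then have "card U dvd p ^ k" using card_subgroup_dvd[OF U] by (simp add: Coset.order_def)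
  then show ?thesis using divides_primepow_nat[OF prime_p] by blast
qed

text \<open>For an isomorphism \<open>\<alpha>\<close> from \<open>R\<close> to \<open>Q\<close>
  this carries conjugation by \<open>x\<close> on \<open>R\<close> over to \<open>Q\<close>. As
  \<open>x\<close> runs through \<open>N R\<close>, it yields a \<open>p\<close>-subgroup of the
  automorphism group of \<open>Q\<close>, ready for Sylow conjugation.\<close>

definition transport :: "'a set \<Rightarrow> 'a set \<Rightarrow> ('a \<Rightarrow> 'a) \<Rightarrow> 'a \<Rightarrow> 'a \<Rightarrow> 'a" where
  "transport R Q \<alpha> x = restrict (\<lambda>z. \<alpha> (conjm P x (inv_into R \<alpha> z))) Q"

lemma transport_apply:
  assumes "\<alpha> \<in> Hom R Q" "\<alpha> ` R = Q" "z \<in> R"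
  shows "transport R Q \<alpha> x (\<alpha> z) = \<alpha> (conjm P x z)"
  using assms inv_into_f_f[OF HomD(4)[OF assms(1)] assms(3)] Hom_carrier(1)[OF assms(1,3)]
  by (simp add: transport_def)

lemma transport_hom:
  assumes \<alpha>: "\<alpha> \<in> Hom R Q" "\<alpha> ` R = Q"
  shows "group_hom (P\<lparr>carrier := N R\<rparr>) (AutF Hom Q) (transport R Q \<alpha>)"
proof (intro group_hom.intro group_hom_axioms.intro homI)
  have R: "subgroup R P" and Q: "subgroup Q P" using HomD(1,2)[OF \<alpha>(1)] .
  show "group (P\<lparr>carrier := N R\<rparr>)" by (rule subgroup_imp_group[OF N_subgroup[OF R]])
  show "group (AutF Hom Q)" by (rule AutF_group[OF Q])
  have "transport R Q \<alpha> x \<in> Hom Q Q" if x: "x \<in> N R" for x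
  proof -
    have "compose Q (compose R \<alpha> (restrict (conjm P x) R)) (restrict (inv_into R \<alpha>) Q) \<in> Hom Q Q"
      by (rule Hom_compose[OF Hom_inverse[OF \<alpha>] Hom_compose[OF conj_AutF[OF R x] \<alpha>(1)]])
    moreover have "compose Q (compose R \<alpha> (restrict (conjm P x) R)) (restrict (inv_into R \<alpha>) Q)
      = transport R Q \<alpha> x"
      unfolding transport_def compose_def using \<alpha>(2)
      by (intro restrict_ext) (auto simp: inv_into_into)
    ultimately show ?thesis by simp
  qed
  then show cl: "transport R Q \<alpha> x \<in> carrier (AutF Hom Q)"
    if "x \<in> carrier (P\<lparr>carrier := N R\<rparr>)" for x using that by simp
  show "transport R Q \<alpha> (x \<otimes>\<^bsub>P\<lparr>carrier := N R\<rparr>\<^esub> y) =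
     transport R Q \<alpha> x \<otimes>\<^bsub>AutF Hom Q\<^esub> transport R Q \<alpha> y"
    if "x \<in> carrier (P\<lparr>carrier := N R\<rparr>)" "y \<in> carrier (P\<lparr>carrier := N R\<rparr>)" for x y
  proof (rule extensionalityI[of _ Q])
    fix z assume "z \<in> Q"
    then obtain w where w: "w \<in> R" "z = \<alpha> w" using \<alpha>(2) by blast
    have xy: "x \<in> N R" "y \<in> N R" using that by auto
    have yw: "conjm P y w \<in> R" using N_D(2)[OF xy(2)] w(1) by blast
    show "transport R Q \<alpha> (x \<otimes>\<^bsub>P\<lparr>carrier := N R\<rparr>\<^esub> y) z =
      (transport R Q \<alpha> x \<otimes>\<^bsub>AutF Hom Q\<^esub> transport R Q \<alpha> y) z"
      using \<open>z \<in> Q\<close> w yw N_D(1)[OF xy(1)] N_D(1)[OF xy(2)] Hom_carrier[OF \<alpha>(1) w(1)]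
      by (simp add: transport_apply[OF \<alpha>] conjm_comp)
  qed (auto simp: transport_def AutF_def)
qed

text \<open>For \<open>\<alpha>\<close> the identity of \<open>Q\<close>, transport is the map from
  \<open>N Q\<close> to the automorphism group given by conjugation, and \<open>AutP P Q\<close> is
  its image.\<close>

lemma AutP_subgroup:
  assumes Q: "subgroup Q P"
  shows "subgroup (AutP P Q) (AutF Hom Q)" "\<exists>k. card (AutP P Q) = p ^ k"
proof -
  obtain k where k: "card (N Q) = p ^ k" using card_subgroup_p_power[OF N_subgroup[OF Q]] by blast
  have idQ: "restrict id Q \<in> Hom Q Q" "restrict id Q ` Q = Q" using incl_Hom[OF Q Q] by auto
  interpret t: group_hom "P\<lparr>carrier := N Q\<rparr>" "AutF Hom Q" "transport Q Q (restrict id Q)"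
    by (rule transport_hom[OF idQ])
  have "transport Q Q (restrict id Q) x = restrict (conjm P x) Q" if "x \<in> N Q" for x
  proof (rule extensionalityI[of _ Q])
    fix z assume z: "z \<in> Q"
    have "conjm P x z \<in> Q" using N_D(2)[OF that] z by blast
    then show "transport Q Q (restrict id Q) x z = restrict (conjm P x) Q z"
      using transport_apply[OF idQ z, of x] z by simp
  qed (auto simp: transport_def)
  then have "transport Q Q (restrict id Q) ` N Q = AutP P Q" by (auto simp: AutP_def)
  then show "subgroup (AutP P Q) (AutF Hom Q)" "\<exists>k. card (AutP P Q) = p ^ k"
    using t.p_group_image[OF prime_p, of k] k by (auto simp: Coset.order_def)
qed

section \<open>Extending morphisms to normalizers\<close>

lemma extension:
  assumes "\<phi> \<in> Hom Q R" "\<phi> ` Q = R" "fully_normalized P Hom R"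
  obtains \<psi> where "\<psi> \<in> Hom (N_phi P Q \<phi>) (carrier P)" "\<And>z. z \<in> Q \<Longrightarrow> \<psi> z = \<phi> z"
proof -
  have "F_iso Hom Q R \<phi>" using assms by (simp add: F_iso_def)
  then show thesis using sat assms(3) that unfolding saturated_fusion_system_def by blast
qed

text \<open>For \<open>x\<close> in \<open>Q\<close> the witness required by \<open>N_phi\<close> is
  \<open>\<phi> x\<close>.\<close>

lemma le_N_phi:
  assumes "\<phi> \<in> Hom Q R" "\<phi> ` Q = R"
  shows "Q \<subseteq> N_phi P Q \<phi>"
proof
  fix x assume x: "x \<in> Q"
  have "x \<in> N Q" using subgroup_le_normalizer_in[OF HomD(1)[OF assms(1)] fin_subgroup[OF HomD(1)[OF assms(1)]]] x
    by blast
  moreover have "\<phi> x \<in> N R"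
    using subgroup_le_normalizer_in[OF HomD(2)[OF assms(1)] fin_subgroup[OF HomD(2)[OF assms(1)]]]
      Hom_carrier(1)[OF assms(1) x] by blast
  ultimately show "x \<in> N_phi P Q \<phi>"
    using Hom_conjm[OF assms(1) x] assms(2) by (auto simp: N_phi_def)
qed

text \<open>For a subgroup \<open>Q\<close>, \<open>AutP P Q\<close> is a \<open>p\<close>-subgroup
  by \<open>AutP_subgroup\<close>, so the condition on the index makes it a Sylow subgroup.\<close>

abbreviation Sylow_AutP :: "'a set \<Rightarrow> bool" where
  "Sylow_AutP Q \<equiv> \<not> p dvd order (AutF Hom Q) div card (AutP P Q)"

text \<open>The \<open>p\<close>-group that \<open>N R\<close> induces on \<open>Q\<close> through
  \<open>\<alpha>\<close> is conjugate into \<open>AutP P Q\<close>. After correcting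
  \<open>\<alpha>\<close> by the conjugating automorphism \<open>\<beta>\<close>, every element of
  \<open>N R\<close> satisfies the condition in \<open>N_phi\<close>, and saturation gives an
  extension.\<close>

lemma Sylow_AutP_extension:
  assumes Q: "fully_normalized P Hom Q" "Sylow_AutP Q"
    and \<alpha>: "\<alpha> \<in> Hom R Q" "\<alpha> ` R = Q"
  obtains \<beta> S \<psi> where "\<beta> \<in> Hom Q Q" "N R \<subseteq> S" "\<psi> \<in> Hom S (carrier P)"
    "\<And>z. z \<in> R \<Longrightarrow> \<psi> z = \<beta> (\<alpha> z)"
proof -
  have Qs: "subgroup Q P" and Rs: "subgroup R P" using HomD(1,2)[OF \<alpha>(1)] by auto
  interpret A: group "AutF Hom Q" by (rule AutF_group[OF Qs])
  interpret t: group_hom "P\<lparr>carrier := N R\<rparr>" "AutF Hom Q" "transport R Q \<alpha>"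
    by (rule transport_hom[OF \<alpha>])
  obtain k where k: "card (N R) = p ^ k" using card_subgroup_p_power[OF N_subgroup[OF Rs]] by blast
  let ?T = "transport R Q \<alpha> ` N R"
  obtain j where T: "subgroup ?T (AutF Hom Q)" "card ?T = p ^ j"
    using t.p_group_image[OF prime_p, of k] k by (auto simp: Coset.order_def)
  obtain h where h: "h \<in> carrier (AutF Hom Q)"
    "\<And>t. t \<in> ?T \<Longrightarrow> inv\<^bsub>AutF Hom Q\<^esub> h \<otimes>\<^bsub>AutF Hom Q\<^esub> t \<otimes>\<^bsub>AutF Hom Q\<^esub> h \<in> AutP P Q"
    using A.p_subgroup_conj_into_Sylow[OF prime_p _ AutP_subgroup(1)[OF Qs] Q(2) T] finite_AutF
    by auto
  define \<beta> where "\<beta> = inv\<^bsub>AutF Hom Q\<^esub> h"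
  have \<beta>: "\<beta> \<in> Hom Q Q" using A.inv_closed[OF h(1)] by (simp add: \<beta>_def)
  have h\<beta>: "h (\<beta> z) = z" if "z \<in> Q" for z
    using A.r_inv[OF h(1)] mult_AutF[OF that, of h \<beta>] one_AutF[OF that] by (simp add: \<beta>_def)
  define \<gamma> where "\<gamma> = compose R \<beta> \<alpha>"
  have \<gamma>: "\<gamma> \<in> Hom R Q" unfolding \<gamma>_def by (rule Hom_compose[OF \<alpha>(1) \<beta>])
  have \<gamma>z: "\<gamma> z = \<beta> (\<alpha> z)" if "z \<in> R" for z using that by (simp add: \<gamma>_def compose_def)
  have "\<gamma> ` R = \<beta> ` \<alpha> ` R" unfolding image_image using \<gamma>z by (intro image_cong) auto
  then have \<gamma>im: "\<gamma> ` R = Q" using \<alpha>(2) Hom_Aut_image[OF \<beta>] by simp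
  \<comment> \<open>The conjugate of the transported \<open>x\<close> lies in
    \<open>AutP P Q\<close>, so it is conjugation by some \<open>y\<close> in \<open>N Q\<close>;
    this \<open>y\<close> is the witness for \<open>x\<close>.\<close>
  have "N R \<subseteq> N_phi P R \<gamma>"
  proof
    fix x assume x: "x \<in> N R"
    then obtain y where y: "y \<in> N Q"
      "\<beta> \<otimes>\<^bsub>AutF Hom Q\<^esub> transport R Q \<alpha> x \<otimes>\<^bsub>AutF Hom Q\<^esub> h = restrict (conjm P y) Q"
      using h(2)[of "transport R Q \<alpha> x"] by (auto simp: AutP_def \<beta>_def)
    have "\<gamma> (conjm P x z) = conjm P y (\<gamma> z)" if z: "z \<in> R" for z
    proof -
      have az: "\<alpha> z \<in> Q" by (rule Hom_carrier(1)[OF \<alpha>(1) z])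
      have bz: "\<beta> (\<alpha> z) \<in> Q" by (rule Hom_carrier(1)[OF \<beta> az])
      have xz: "conjm P x z \<in> R" using N_D(2)[OF x] z by blast
      have "conjm P y (\<beta> (\<alpha> z)) = (\<beta> \<otimes>\<^bsub>AutF Hom Q\<^esub> transport R Q \<alpha> x \<otimes>\<^bsub>AutF Hom Q\<^esub> h) (\<beta> (\<alpha> z))"
        using y(2) bz by simp
      also have "\<dots> = \<beta> (transport R Q \<alpha> x (\<alpha> z))"
        using bz az by (simp add: h\<beta>)
      also have "\<dots> = \<beta> (\<alpha> (conjm P x z))" using transport_apply[OF \<alpha> z] by simp
      finally show ?thesis using \<gamma>z[OF z] \<gamma>z[OF xz] by simp
    qed
    then show "x \<in> N_phi P R \<gamma>" using x y(1) \<gamma>im by (auto simp: N_phi_def)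
  qed
  moreover obtain \<psi> where "\<psi> \<in> Hom (N_phi P R \<gamma>) (carrier P)" "\<And>z. z \<in> R \<Longrightarrow> \<psi> z = \<gamma> z"
    using extension[OF \<gamma> \<gamma>im Q(1)] by blast
  ultimately show thesis using that[OF \<beta>] \<gamma>z by metis
qed

end

text \<open>Take any \<open>x\<close> outside \<open>Q\<close> and the least \<open>j\<close> for
  which its \<open>p ^ j\<close>-th power lies in \<open>Q\<close>; the power with exponent
  \<open>p ^ (j - 1)\<close> has the required property.\<close>

lemma (in group) order_p_modulo_subgroup:
  assumes p: "Factorial_Ring.prime (p::nat)" and M: "subgroup M G" "card M = p ^ k"
    and Q: "subgroup Q G" "Q \<subset> M"
  obtains x where "x \<in> M" "x \<notin> Q" "x [^] p \<in> Q"
proof -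
  obtain x where x: "x \<in> M" "x \<notin> Q" using Q(2) by blast
  have xc: "x \<in> carrier G" by (rule subgroup.mem_carrier[OF M(1) x(1)])
  let ?I = "\<lambda>j. x [^] (p ^ j) \<in> Q"
  have "x [^] (p ^ k) = \<one>" using pow_card_subgroup[OF M(1) x(1)] M(2) by simp
  then have I: "?I k" using subgroup.one_closed[OF Q(1)] by simp
  define j where "j = (LEAST j. ?I j)"
  have j: "?I j" unfolding j_def using I by (rule LeastI)
  have "j \<noteq> 0" using j x(2) xc by (intro notI) simp
  then obtain i where i: "j = Suc i" using not0_implies_Suc by blast
  have ni: "\<not> ?I i" using not_less_Least[of i ?I] i unfolding j_def by simp
  have "(x [^] (p ^ i)) [^] p = x [^] (p ^ j)" using xc i by (simp add: nat_pow_pow mult.commute)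
  moreover have "x [^] m \<in> M" for m :: nat
  proof (induction m)
    case 0
    then show ?case using subgroup.one_closed[OF M(1)] by simp
  next
    case (Suc m)
    then show ?case using subgroup.m_closed[OF M(1)] x(1) by simp
  qed
  ultimately show thesis using that[of "x [^] (p ^ i)"] j ni by simp
qed

text \<open>On commuting elements taking powers is multiplicative, so the set of powers is already a
  subgroup and generating adds nothing.\<close>

lemma (in group) mho_eq_powers:
  assumes A: "subgroup A G" and comm: "\<And>a b. \<lbrakk>a \<in> A; b \<in> A\<rbrakk> \<Longrightarrow> a \<otimes> b = b \<otimes> a"
  shows "mho G p n A = {a [^] (p ^ n) | a. a \<in> A}" "subgroup (mho G p n A) G"
proof -
  let ?S = "{a [^] (p ^ n) | a. a \<in> A}"
  have Ac: "a \<in> carrier G" if "a \<in> A" for a by (rule subgroup.mem_carrier[OF A that])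
  have S: "subgroup ?S G"
  proof (rule subgroupI)
    show "?S \<subseteq> carrier G" using Ac by auto
    show "?S \<noteq> {}" using subgroup.one_closed[OF A] by blast
  next
    fix s assume "s \<in> ?S"
    then obtain a where a: "a \<in> A" "s = a [^] (p ^ n)" by blast
    then have "inv s = (inv a) [^] (p ^ n)" using Ac by (simp add: nat_pow_inv)
    then show "inv s \<in> ?S" using subgroup.m_inv_closed[OF A a(1)] by blast
  next
    fix s t assume "s \<in> ?S" "t \<in> ?S"
    then obtain a b where ab: "a \<in> A" "s = a [^] (p ^ n)" "b \<in> A" "t = b [^] (p ^ n)" by blast
    then have "s \<otimes> t = (a \<otimes> b) [^] (p ^ n)"
      using pow_mult_distrib[OF comm[OF ab(1,3)]] Ac by simp
    then show "s \<otimes> t \<in> ?S" using subgroup.m_closed[OF A ab(1,3)] by blast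
  qed
  have "mho G p n A = ?S" unfolding mho_def
  proof
    show "generate G ?S \<subseteq> ?S" by (rule generate_subgroup_incl[OF subset_refl S])
    show "?S \<subseteq> generate G ?S" by (auto intro: generate.incl)
  qed
  then show "mho G p n A = ?S" "subgroup (mho G p n A) G" using S by auto
qed

lemma (in group) center_of_subgroup_is_subgroup:
  assumes Q: "subgroup Q G"
  shows "subgroup {v \<in> Q. \<forall>z \<in> Q. z \<otimes> v = v \<otimes> z} G"
proof (rule subgroupI)
  have Qc: "z \<in> carrier G" if "z \<in> Q" for z by (rule subgroup.mem_carrier[OF Q that])
  let ?V = "{v \<in> Q. \<forall>z \<in> Q. z \<otimes> v = v \<otimes> z}"
  show "?V \<subseteq> carrier G" using Qc by blast
  show "?V \<noteq> {}" using subgroup.one_closed[OF Q] Qc by force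
  fix a assume a: "a \<in> ?V"
  have "z \<otimes> inv a = inv a \<otimes> z" if z: "z \<in> Q" for z
  proof -
    have zc: "z \<in> carrier G" and ac: "a \<in> carrier G" using z a Qc by auto
    have "conjm G z a = a" using z a zc ac by (simp add: conjm_eq_iff_commute)
    then have "z \<otimes> a \<otimes> inv z = a" by (simp add: conjm_def)
    moreover have "a \<otimes> z = z \<otimes> a" using z a by simp
    then have "conjm G a z = z" using zc ac by (simp add: conjm_eq_iff_commute)
    then have "conjm G (inv a) z = z" using conjm_inv_conjm(1)[OF ac zc] by simp
    then show ?thesis using zc ac by (simp add: conjm_eq_iff_commute)
  qed
  then show "inv a \<in> ?V" using a subgroup.m_inv_closed[OF Q] by blast
  fix b assume b: "b \<in> ?V"
  have "z \<otimes> (a \<otimes> b) = a \<otimes> b \<otimes> z" if z: "z \<in> Q" for z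
  proof -
    have c: "z \<in> carrier G" "a \<in> carrier G" "b \<in> carrier G" using z a b Qc by auto
    have "z \<otimes> (a \<otimes> b) = z \<otimes> a \<otimes> b" using c by (simp add: m_assoc)
    also have "\<dots> = a \<otimes> (z \<otimes> b)" using z a c by (simp add: m_assoc)
    also have "\<dots> = a \<otimes> b \<otimes> z" using z b c by (simp add: m_assoc)
    finally show ?thesis .
  qed
  then show "a \<otimes> b \<in> ?V" using a b subgroup.m_closed[OF Q] by blast
qed

section \<open>Fully normalized subgroups have Sylow automizers\<close>

context saturated_fusion
begin

lemma fully_normalized_exists:
  assumes Q: "subgroup Q P"
  obtains R \<alpha> where "\<alpha> \<in> Hom Q R" "\<alpha> ` Q = R" "fully_normalized P Hom R"
proof -
  have id: "F_isomorphic Hom Q Q"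
    unfolding F_isomorphic_def F_iso_def
    using incl_Hom[OF Q Q] by (intro exI[of _ "restrict id Q"]) auto
  \<comment> \<open>The bound ensures that a conjugate of \<open>Q\<close> with largest normalizer
    exists.\<close>
  have "\<forall>R. F_isomorphic Hom Q R \<longrightarrow> card (N R) < Suc (card (carrier P))"
    using finP by (auto simp: normalizer_in_def less_Suc_eq_le intro: card_mono)
  then obtain R where R: "F_isomorphic Hom Q R"
    "\<And>S. F_isomorphic Hom Q S \<Longrightarrow> card (N S) \<le> card (N R)"
    using ex_has_greatest_nat[of "F_isomorphic Hom Q" Q "\<lambda>R. card (N R)"] id by blast
  obtain \<alpha> where \<alpha>: "\<alpha> \<in> Hom Q R" "\<alpha> ` Q = R"
    using R(1) by (auto simp: F_isomorphic_def F_iso_def)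
  \<comment> \<open>Maximality is known among the conjugates of \<open>Q\<close>; by transitivity it
    holds among those of \<open>R\<close>, as full normalization demands.\<close>
  have "F_isomorphic Hom Q S" if S: "F_isomorphic Hom R S" for S
  proof -
    obtain \<beta> where \<beta>: "\<beta> \<in> Hom R S" "\<beta> ` R = S"
      using S by (auto simp: F_isomorphic_def F_iso_def)
    have "compose Q \<beta> \<alpha> \<in> Hom Q S" by (rule Hom_compose[OF \<alpha>(1) \<beta>(1)])
    moreover have "compose Q \<beta> \<alpha> ` Q = S" using \<alpha>(2) \<beta>(2) by (auto simp: compose_def)
    ultimately show ?thesis by (auto simp: F_isomorphic_def F_iso_def)
  qed
  then have "fully_normalized P Hom R"
    using R(2) HomD(2)[OF \<alpha>(1)] by (simp add: fully_normalized_def)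
  then show thesis using that \<alpha> by blast
qed

lemma card_Hom_image: "\<phi> \<in> Hom Q R \<Longrightarrow> card (\<phi> ` Q) = card Q"
  using HomD(4) by (rule card_image)

lemma Q_psubset_N: "\<lbrakk>subgroup Q P; Q \<noteq> carrier P\<rbrakk> \<Longrightarrow> Q \<subset> N Q"
  by (rule proper_subgroup_of_normalizer_in[OF p_grp prime_p])

text \<open>The induction step for the Sylow property: a \<open>p\<close>-element
  \<open>\<chi>\<close> normalizing \<open>AutP P Q\<close> is itself induced by \<open>P\<close>.
  It extends to \<open>N Q\<close>; on a fully normalized copy \<open>R\<close> of
  \<open>N Q\<close> the induction hypothesis makes a suitable power of the extension inner after
  conjugation, and the conjugating element is traced back to \<open>N Q\<close>.\<close>

lemma fully_normalized_p_element:
  assumes Q: "fully_normalized P Hom Q" "Q \<noteq> carrier P"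
    and IH: "\<And>R. \<lbrakk>fully_normalized P Hom R; card Q < card R\<rbrakk> \<Longrightarrow> Sylow_AutP R"
    and \<chi>: "\<chi> \<in> Hom Q Q" and pe: "\<chi> [^]\<^bsub>AutF Hom Q\<^esub> (p ^ j) = \<one>\<^bsub>AutF Hom Q\<^esub>"
    and norm: "\<And>x. x \<in> N Q \<Longrightarrow> \<exists>y \<in> N Q. \<forall>z \<in> Q. \<chi> (conjm P x z) = conjm P y (\<chi> z)"
  shows "\<chi> \<in> AutP P Q"
proof -
  have Qs: "subgroup Q P" using Q(1) by (simp add: fully_normalized_def)
  have Qn: "Q \<subseteq> N Q" using Q_psubset_N[OF Qs Q(2)] by blast
  interpret A: group "AutF Hom Q" by (rule AutF_group[OF Qs])
  have \<chi>im: "\<chi> ` Q = Q" by (rule Hom_Aut_image[OF \<chi>])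
  have "N_phi P Q \<chi> = N Q" using norm \<chi>im by (auto simp: N_phi_def)
  then obtain \<psi> where \<psi>0: "\<psi> \<in> Hom (N Q) (carrier P)" and \<psi>\<chi>: "\<And>z. z \<in> Q \<Longrightarrow> \<psi> z = \<chi> z"
    using extension[OF \<chi> \<chi>im Q(1)] by metis
  \<comment> \<open>The extension maps \<open>Q\<close> onto \<open>Q\<close>, hence elements
    normalizing \<open>Q\<close> to elements normalizing \<open>Q\<close>.\<close>
  have "\<psi> x \<in> N Q" if x: "x \<in> N Q" for x
  proof (rule normalizer_inI[OF Qs Hom_carrier(2)[OF \<psi>0 x] fin_subgroup[OF Qs]])
    show "conjm P (\<psi> x) ` Q \<subseteq> Q"
    proof
      fix w assume "w \<in> conjm P (\<psi> x) ` Q"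
      then obtain z where z: "z \<in> Q" "w = conjm P (\<psi> x) (\<psi> z)" using \<chi>im \<psi>\<chi> by force
      have "conjm P x z \<in> Q" using N_D(2)[OF x] z(1) by blast
      moreover have "w = \<psi> (conjm P x z)" using Hom_conjm[OF \<psi>0 x] z Qn by auto
      ultimately show "w \<in> Q" using \<psi>\<chi> Hom_carrier(1)[OF \<chi>] by simp
    qed
  qed
  then have \<psi>: "\<psi> \<in> Hom (N Q) (N Q)"
    by (intro Hom_codomain[OF \<psi>0 _ N_subgroup[OF Qs]]) blast
  obtain R \<tau> where \<tau>: "\<tau> \<in> Hom (N Q) R" "\<tau> ` N Q = R" and R: "fully_normalized P Hom R"
    using fully_normalized_exists[OF N_subgroup[OF Qs]] .
  have Rs: "subgroup R P" by (rule HomD(2)[OF \<tau>(1)])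
  interpret B: group "AutF Hom R" by (rule AutF_group[OF Rs])
  have cardR: "card R = card (N Q)" using card_Hom_image[OF \<tau>(1)] \<tau>(2) by simp
  have "card Q < card (N Q)"
    by (rule psubset_card_mono[OF fin_subgroup[OF N_subgroup[OF Qs]] Q_psubset_N[OF Qs Q(2)]])
  then have SR: "Sylow_AutP R" using IH[OF R] cardR by simp
  \<comment> \<open>The extension \<open>\<psi>\<close> viewed as an automorphism of
    \<open>R\<close> via \<open>\<tau>\<close>.\<close>
  define g0 where "g0 = compose R (compose (N Q) \<tau> \<psi>) (restrict (inv_into (N Q) \<tau>) R)"
  have g0: "g0 \<in> carrier (AutF Hom R)"
    unfolding g0_def carrier_AutF
    by (rule Hom_compose[OF Hom_inverse[OF \<tau>] Hom_compose[OF \<psi> \<tau>(1)]])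
  have g0\<tau>: "g0 (\<tau> x) = \<tau> (\<psi> x)" if x: "x \<in> N Q" for x
    using x Hom_carrier(1)[OF \<tau>(1) x] inv_into_f_f[OF HomD(4)[OF \<tau>(1)] x]
    by (simp add: g0_def compose_def)
  have pw: "(g0 [^]\<^bsub>AutF Hom R\<^esub> k) (\<tau> z) = \<tau> ((\<chi> [^]\<^bsub>AutF Hom Q\<^esub> k) z)"
    if z: "z \<in> Q" for k :: nat and z using z
  proof (induction k arbitrary: z)
    case 0
    then show ?case using Hom_carrier(1)[OF \<tau>(1)] Qn by auto
  next
    case (Suc k)
    have "\<tau> z \<in> R" "\<psi> z = \<chi> z" "\<chi> z \<in> Q"
      using Suc.prems Hom_carrier(1)[OF \<tau>(1)] Qn \<psi>\<chi> Hom_carrier(1)[OF \<chi>] by auto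
    then show ?case using Suc.prems Suc.IH[of "\<chi> z"] g0\<tau>[of z] Qn by auto
  qed
  obtain a m where am: "order (AutF Hom R) = p ^ a * m" "\<not> p dvd m"
  proof -
    have "order (AutF Hom R) > 0" using finite_AutF B.order_gt_0_iff_finite by simp
    then show thesis using that prime_power_canonical[OF prime_p] by (metis mult.commute)
  qed
  have cop: "coprime m (p ^ j)"
    using prime_imp_coprime[OF prime_p am(2)] by (simp add: coprime_commute)
  then obtain c where c: "[m * c = Suc 0] (mod p ^ j)" using cong_solve_coprime_nat by blast
  \<comment> \<open>The exponent is divisible by \<open>m\<close> and congruent to 1 modulo
    \<open>p ^ j\<close>. So \<open>g0 [^] e\<close> has \<open>p\<close>-power order and still acts
    as \<open>\<chi>\<close> on the copy of \<open>Q\<close>. The summand \<open>p ^ j\<close> keeps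
    \<open>e\<close> positive, since \<open>c\<close> may be 0 when \<open>j = 0\<close>.\<close>
  define e where "e = m * (c + p ^ j)"
  have "m > 0" using am(2) by (cases m) auto
  then have e1: "e \<ge> 1" using prime_gt_0_nat[OF prime_p] by (simp add: e_def Suc_le_eq)
  have "[e = 1] (mod p ^ j)" using c by (simp add: e_def algebra_simps cong_def)
  then have "p ^ j dvd e - 1" using e1 by (simp add: cong_altdef_nat cong_sym_eq)
  then obtain q where q: "e = p ^ j * q + 1" using e1 by (metis dvdE le_add_diff_inverse2)
  have \<chi>e: "\<chi> [^]\<^bsub>AutF Hom Q\<^esub> e = \<chi>"
  proof -
    have "\<chi> [^]\<^bsub>AutF Hom Q\<^esub> (p ^ j * q) = \<one>\<^bsub>AutF Hom Q\<^esub>"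
      using A.nat_pow_pow[of \<chi> "p ^ j" q] \<chi> pe by simp
    then show ?thesis using \<chi> A.l_one[of \<chi>] unfolding q by simp
  qed
  define g where "g = g0 [^]\<^bsub>AutF Hom R\<^esub> e"
  have g: "g \<in> carrier (AutF Hom R)" using g0 unfolding g_def by (rule B.nat_pow_closed)
  have "g [^]\<^bsub>AutF Hom R\<^esub> (p ^ a) = g0 [^]\<^bsub>AutF Hom R\<^esub> (order (AutF Hom R) * (c + p ^ j))"
    using B.nat_pow_pow[OF g0] by (simp add: g_def e_def am(1) mult_ac)
  also have "\<dots> = \<one>\<^bsub>AutF Hom R\<^esub>"
    using B.nat_pow_pow[OF g0, of "order (AutF Hom R)", symmetric] B.pow_order_eq_1[OF g0]
    by simp
  finally have "B.ord g dvd p ^ a" using B.pow_eq_id[OF g] by blast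
  then obtain b where "B.ord g = p ^ b" using divides_primepow_nat[OF prime_p] by blast
  then have T: "subgroup (generate (AutF Hom R) {g}) (AutF Hom R)"
    "card (generate (AutF Hom R) {g}) = p ^ b"
    using B.generate_is_subgroup[of "{g}"] B.generate_pow_card[OF g] g by auto
  obtain h where h: "h \<in> carrier (AutF Hom R)" and
    "\<And>t. t \<in> generate (AutF Hom R) {g} \<Longrightarrow>
       inv\<^bsub>AutF Hom R\<^esub> h \<otimes>\<^bsub>AutF Hom R\<^esub> t \<otimes>\<^bsub>AutF Hom R\<^esub> h \<in> AutP P R"
    using B.p_subgroup_conj_into_Sylow[OF prime_p _ AutP_subgroup(1)[OF Rs] SR T] finite_AutF
    by auto
  then have "inv\<^bsub>AutF Hom R\<^esub> h \<otimes>\<^bsub>AutF Hom R\<^esub> g \<otimes>\<^bsub>AutF Hom R\<^esub> h \<in> AutP P R"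
    using generate.incl[of g "{g}"] by blast
  then obtain y where y: "y \<in> N R"
    "inv\<^bsub>AutF Hom R\<^esub> h \<otimes>\<^bsub>AutF Hom R\<^esub> g \<otimes>\<^bsub>AutF Hom R\<^esub> h = restrict (conjm P y) R"
    by (auto simp: AutP_def)
  define h' where "h' = inv\<^bsub>AutF Hom R\<^esub> h"
  have h': "h' \<in> Hom R R" using B.inv_closed[OF h] by (simp add: h'_def)
  have hh': "h (h' z) = z" if "z \<in> R" for z
    using B.r_inv[OF h] mult_AutF[OF that, of h h'] one_AutF[OF that] by (simp add: h'_def)
  \<comment> \<open>Changing \<open>\<tau>\<close> by the inverse of \<open>h\<close> makes the
    automorphism of \<open>R\<close> conjugation by \<open>y\<close>; on \<open>Q\<close> it then
    corresponds to \<open>\<chi>\<close>.\<close>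
  define \<sigma> where "\<sigma> = compose (N Q) h' \<tau>"
  have \<sigma>: "\<sigma> \<in> Hom (N Q) R" unfolding \<sigma>_def by (rule Hom_compose[OF \<tau>(1) h'])
  have \<sigma>z: "\<sigma> z = h' (\<tau> z)" if "z \<in> N Q" for z using that by (simp add: \<sigma>_def compose_def)
  have "\<sigma> ` N Q = h' ` \<tau> ` N Q" unfolding image_image using \<sigma>z by (intro image_cong) auto
  then have \<sigma>im: "\<sigma> ` N Q = R" using \<tau>(2) Hom_Aut_image[OF h'] by simp
  have key: "conjm P y (\<sigma> z) = \<sigma> (\<chi> z)" if z: "z \<in> Q" for z
  proof -
    have zN: "z \<in> N Q" "\<chi> z \<in> N Q" using z Qn Hom_carrier(1)[OF \<chi> z] by auto
    have tz: "\<tau> z \<in> R" by (rule Hom_carrier(1)[OF \<tau>(1) zN(1)])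
    have sz: "\<sigma> z \<in> R" by (rule Hom_carrier(1)[OF \<sigma> zN(1)])
    have "conjm P y (\<sigma> z) = (h' \<otimes>\<^bsub>AutF Hom R\<^esub> g \<otimes>\<^bsub>AutF Hom R\<^esub> h) (\<sigma> z)"
      using y(2) sz by (simp add: h'_def)
    also have "\<dots> = h' (g (h (h' (\<tau> z))))"
      using sz Hom_carrier(1)[OF h[unfolded carrier_AutF] sz] \<sigma>z[OF zN(1)] by simp
    also have "\<dots> = h' (\<tau> (\<chi> z))"
      using hh'[OF tz] pw[OF z, of e] by (simp add: g_def \<chi>e)
    finally show ?thesis using \<sigma>z[OF zN(2)] by simp
  qed
  define Q' where "Q' = \<sigma> ` Q"
  have Q's: "subgroup Q' P" unfolding Q'_def by (rule Hom_image_subgroup[OF \<sigma> Qs Qn])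
  have yQ': "y \<in> N Q'"
  proof (rule normalizer_inI[OF Q's N_D(1)[OF y(1)] fin_subgroup[OF Q's]])
    show "conjm P y ` Q' \<subseteq> Q'"
      using key Hom_carrier(1)[OF \<chi>] by (auto simp: Q'_def)
  qed
  \<comment> \<open>Elements of \<open>R\<close> are images of elements normalizing
    \<open>Q\<close>. Since \<open>Q\<close> is fully normalized, \<open>N Q'\<close> is no larger
    than \<open>N Q\<close>, which has the size of \<open>R\<close>; hence
    \<open>N Q' = R\<close>.\<close>
  have "R \<subseteq> N Q'"
  proof
    fix r assume "r \<in> R"
    then obtain x where x: "x \<in> N Q" "r = \<sigma> x" using \<sigma>im by blast
    show "r \<in> N Q'"
    proof (rule normalizer_inI[OF Q's _ fin_subgroup[OF Q's]])
      show "r \<in> carrier P" using x Hom_carrier(2)[OF \<sigma>] by simp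
      have "conjm P r (\<sigma> z) \<in> Q'" if z: "z \<in> Q" for z
      proof -
        have "conjm P x z \<in> Q" using N_D(2)[OF x(1)] z by blast
        then have "\<sigma> (conjm P x z) \<in> Q'" by (simp add: Q'_def)
        moreover have "z \<in> N Q" using z Qn by blast
        ultimately show ?thesis using Hom_conjm[OF \<sigma> x(1)] x(2) by simp
      qed
      then show "conjm P r ` Q' \<subseteq> Q'" by (auto simp: Q'_def)
    qed
  qed
  moreover have "card (N Q') \<le> card R"
  proof -
    have "restrict \<sigma> Q \<in> Hom Q Q'"
      by (rule Hom_codomain[OF Hom_restrict[OF \<sigma> Qs Qn] _ Q's]) (simp add: Q'_def)
    then have "F_isomorphic Hom Q Q'"
      unfolding F_isomorphic_def F_iso_def by (intro exI[of _ "restrict \<sigma> Q"]) (simp add: Q'_def)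
    then show ?thesis using Q(1) cardR by (simp add: fully_normalized_def)
  qed
  ultimately have "N Q' = R"
    using card_seteq[OF fin_subgroup[OF N_subgroup[OF Q's]]] by metis
  \<comment> \<open>Since \<open>y\<close> normalizes \<open>Q'\<close>, it lies in
    \<open>R\<close>, the image of \<open>N Q\<close>. By injectivity of \<open>\<sigma>\<close> its
    preimage \<open>u\<close> induces \<open>\<chi>\<close>.\<close>
  then obtain u where u: "u \<in> N Q" "y = \<sigma> u" using yQ' \<sigma>im by blast
  have "\<chi> z = conjm P u z" if z: "z \<in> Q" for z
  proof -
    have zN: "z \<in> N Q" "\<chi> z \<in> N Q" using z Qn Hom_carrier(1)[OF \<chi> z] by auto
    have uz: "conjm P u z \<in> N Q" using N_D(2)[OF u(1)] z Qn by blast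
    have "\<sigma> (\<chi> z) = \<sigma> (conjm P u z)" using key[OF z] u Hom_conjm[OF \<sigma> u(1) zN(1)] by simp
    then show ?thesis using inj_onD[OF HomD(4)[OF \<sigma>]] zN(2) uz by blast
  qed
  then have "\<chi> = restrict (conjm P u) Q"
    by (intro Hom_eqI[OF \<chi> conj_AutF[OF Qs u(1)]]) simp
  then show ?thesis using u(1) by (auto simp: AutP_def)
qed

text \<open>Downward induction on the size of \<open>Q\<close>. For \<open>Q = carrier P\<close> it
  is an axiom of saturation; below, \<open>Sylow_criterion\<close> reduces it to the
  \<open>p\<close>-elements treated in \<open>fully_normalized_p_element\<close>.\<close>

theorem fully_normalized_Sylow:
  "fully_normalized P Hom Q \<Longrightarrow> Sylow_AutP Q"
proof (induction "card (carrier P) - card Q" arbitrary: Q rule: less_induct)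
  case less
  have Qs: "subgroup Q P" using less.prems by (simp add: fully_normalized_def)
  interpret A: group "AutF Hom Q" by (rule AutF_group[OF Qs])
  show ?case
  proof (cases "Q = carrier P")
    case True
    have "N (carrier P) = carrier P"
      using subgroup_le_normalizer_in[OF subgroup_self finP] by (auto simp: normalizer_in_def)
    then have "AutP P Q = Aut_P P" unfolding True AutP_def Aut_P_def by auto
    moreover have "order (AutF Hom Q) = card (Hom (carrier P) (carrier P))"
      using True by (simp add: Coset.order_def)
    ultimately show ?thesis
      using sat by (simp add: saturated_fusion_system_def sylow_sub_def)
  next
    case False
    obtain k where k: "card (AutP P Q) = p ^ k" using AutP_subgroup(2)[OF Qs] by blast
    have IH: "Sylow_AutP R" if "fully_normalized P Hom R" "card Q < card R" for R
    proof (rule less.hyps[OF _ that(1)])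
      have "card R \<le> card (carrier P)"
        using that(1) finP subgroup.subset by (auto simp: fully_normalized_def intro: card_mono)
      then show "card (carrier P) - card R < card (carrier P) - card Q" using that(2) by linarith
    qed
    show ?thesis
    proof (rule A.Sylow_criterion[OF prime_p _ AutP_subgroup(1)[OF Qs] k])
      show "finite (carrier (AutF Hom Q))" using finite_AutF by simp
    next
      fix \<phi> j assume \<phi>: "\<phi> \<in> carrier (AutF Hom Q)"
        and n: "\<And>t. t \<in> AutP P Q \<Longrightarrow> inv\<^bsub>AutF Hom Q\<^esub> \<phi> \<otimes>\<^bsub>AutF Hom Q\<^esub> t \<otimes>\<^bsub>AutF Hom Q\<^esub> \<phi> \<in> AutP P Q"
        and o: "\<phi> [^]\<^bsub>AutF Hom Q\<^esub> (p ^ j) = \<one>\<^bsub>AutF Hom Q\<^esub>"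
      \<comment> \<open>The criterion conjugates by \<open>inv \<phi>\<close> on the left, so the
        map carrying conjugation by \<open>x\<close> to conjugation by \<open>y\<close> is the
        inverse of \<open>\<phi>\<close>.\<close>
      define \<chi> where "\<chi> = inv\<^bsub>AutF Hom Q\<^esub> \<phi>"
      have \<chi>: "\<chi> \<in> Hom Q Q" using A.inv_closed[OF \<phi>] by (simp add: \<chi>_def)
      have \<phi>\<chi>: "\<phi> (\<chi> z) = z" if "z \<in> Q" for z
        using A.r_inv[OF \<phi>] mult_AutF[OF that, of \<phi> \<chi>] one_AutF[OF that] by (simp add: \<chi>_def)
      have "\<chi> \<in> AutP P Q"
      proof (rule fully_normalized_p_element[OF less.prems False IH \<chi>])
        show "\<chi> [^]\<^bsub>AutF Hom Q\<^esub> (p ^ j) = \<one>\<^bsub>AutF Hom Q\<^esub>"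
          using A.nat_pow_inv[OF \<phi>, of "p ^ j"] o by (simp add: \<chi>_def)
      next
        fix x assume x: "x \<in> N Q"
        let ?c = "restrict (conjm P x) Q"
        have "?c \<in> AutP P Q" using x by (auto simp: AutP_def)
        then obtain y where y: "y \<in> N Q"
          "\<chi> \<otimes>\<^bsub>AutF Hom Q\<^esub> ?c \<otimes>\<^bsub>AutF Hom Q\<^esub> \<phi> = restrict (conjm P y) Q"
          using n[of ?c] by (auto simp: AutP_def \<chi>_def)
        have "\<chi> (conjm P x z) = conjm P y (\<chi> z)" if z: "z \<in> Q" for z
        proof -
          have "\<chi> z \<in> Q" by (rule Hom_carrier(1)[OF \<chi> z])
          then have "conjm P y (\<chi> z) = (\<chi> \<otimes>\<^bsub>AutF Hom Q\<^esub> ?c \<otimes>\<^bsub>AutF Hom Q\<^esub> \<phi>) (\<chi> z)"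
            using y(2) by simp
          also have "\<dots> = \<chi> (conjm P x z)"
            using \<open>\<chi> z \<in> Q\<close> z by (simp add: \<phi>\<chi>)
          finally show ?thesis by simp
        qed
        then show "\<exists>y \<in> N Q. \<forall>z \<in> Q. \<chi> (conjm P x z) = conjm P y (\<chi> z)" using y(1) by blast
      qed
      then have "inv\<^bsub>AutF Hom Q\<^esub> \<chi> \<in> AutP P Q"
        by (rule subgroup.m_inv_closed[OF AutP_subgroup(1)[OF Qs]])
      then show "\<phi> \<in> AutP P Q" using \<phi> by (simp add: \<chi>_def)
    qed
  qed
qed

end

section \<open>Extending morphisms over \<open>W\<close>\<close>

locale saturated_fusion_nilpotent = saturated_fusion +
  fixes n :: nat
  assumes nil: "nilpotent_class_le P (n * (p - 1) + 1)"
begin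

section \<open>The central subgroup \<open>W\<close> and the products \<open>W <#> Q\<close>\<close>

abbreviation W :: "'a set" where "W \<equiv> mho P p n (grp_center P)"

lemma grp_center_eq: "grp_center P = {v \<in> carrier P. \<forall>z \<in> carrier P. z \<otimes> v = v \<otimes> z}"
  by (simp add: grp_center_def)

lemma W_powers: "W = {a [^] (p ^ n) | a. a \<in> grp_center P}"
  and W_subgroup: "subgroup W P"
proof -
  have Z: "subgroup (grp_center P) P"
    unfolding grp_center_eq by (rule center_of_subgroup_is_subgroup[OF subgroup_self])
  have "a \<otimes> b = b \<otimes> a" if "a \<in> grp_center P" "b \<in> grp_center P" for a b
    using that unfolding grp_center_def by blast
  then show "W = {a [^] (p ^ n) | a. a \<in> grp_center P}" "subgroup W P"
    using mho_eq_powers[OF Z] by blast+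
qed

lemma W_central:
  assumes "w \<in> W" "x \<in> carrier P"
  shows "x \<otimes> w = w \<otimes> x"
proof -
  obtain a where a: "a \<in> grp_center P" "w = a [^] (p ^ n)" using assms(1) W_powers by auto
  have ac: "a \<in> carrier P" "a \<otimes> x = x \<otimes> a" using a(1) assms(2) unfolding grp_center_def by auto
  show ?thesis
    unfolding a(2) by (rule group_commutes_pow[OF ac(2,1) assms(2), symmetric])
qed

lemma conjm_W: "\<lbrakk>w \<in> W; x \<in> carrier P\<rbrakk> \<Longrightarrow> conjm P x w = w"
  using W_central[of w x] subgroup.mem_carrier[OF W_subgroup, of w] conjm_eq_iff_commute[of x w] by blast

lemma normalizer_in_W: "N W = carrier P"
proof
  show "N W \<subseteq> carrier P" by (auto simp: normalizer_in_def)
  show "carrier P \<subseteq> N W"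
    by (rule subsetI, rule normalizer_inI[OF W_subgroup _ fin_subgroup[OF W_subgroup]])
       (use conjm_W in auto)
qed

lemma W_normal: "W \<lhd> P"
  by (rule normal_invI[OF W_subgroup]) (simp add: conjm_W[unfolded conjm_def])

lemma W_mult_subgroup: "subgroup Q P \<Longrightarrow> subgroup (W <#> Q) P"
  by (rule mult_norm_subgroup[OF W_normal])

lemma W_multI: "\<lbrakk>w \<in> W; q \<in> Q\<rbrakk> \<Longrightarrow> w \<otimes> q \<in> W <#> Q"
  by (auto simp: set_mult_def)

lemma W_le_mult:
  assumes Q: "subgroup Q P" shows "W \<subseteq> W <#> Q"
proof
  fix w assume w: "w \<in> W"
  then have "w \<otimes> \<one> \<in> W <#> Q" by (rule W_multI[OF _ subgroup.one_closed[OF Q]])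
  then show "w \<in> W <#> Q" using subgroup.mem_carrier[OF W_subgroup w] by simp
qed

lemma le_W_mult:
  assumes Q: "subgroup Q P" shows "Q \<subseteq> W <#> Q"
proof
  fix q assume q: "q \<in> Q"
  then have "\<one> \<otimes> q \<in> W <#> Q" by (rule W_multI[OF subgroup.one_closed[OF W_subgroup]])
  then show "q \<in> W <#> Q" using subgroup.mem_carrier[OF Q q] by simp
qed

lemma W_mult_absorb: "\<lbrakk>subgroup Q P; W \<subseteq> Q\<rbrakk> \<Longrightarrow> W <#> Q = Q"
  by (intro equalityI le_W_mult) (auto simp: set_mult_def intro: subgroup.m_closed)

section \<open>Calculus of extensions that preserve \<open>W\<close>\<close>

definition preserving_extension :: "'a set \<Rightarrow> ('a \<Rightarrow> 'a) \<Rightarrow> ('a \<Rightarrow> 'a) \<Rightarrow> bool" where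
  "preserving_extension Q \<phi> \<psi> \<longleftrightarrow>
     \<psi> \<in> Hom (W <#> Q) (carrier P) \<and> (\<forall>z \<in> Q. \<psi> z = \<phi> z) \<and> \<psi> ` W = W"

text \<open>Only the values of \<open>\<phi>\<close> on \<open>Q\<close> matter, so composites and
  inverses can be written as plain functions. The target of the extension is always
  \<open>P\<close>; \<open>preserving_extension_image\<close> recovers the exact image.\<close>

definition W_extendable :: "'a set \<Rightarrow> ('a \<Rightarrow> 'a) \<Rightarrow> bool" where
  "W_extendable Q \<phi> \<longleftrightarrow> (\<exists>\<psi>. preserving_extension Q \<phi> \<psi>)"

text \<open>An extension sends \<open>w \<otimes> q\<close> to
  \<open>\<psi> w \<otimes> \<phi> q\<close>, and \<open>\<psi>\<close> permutes \<open>W\<close>.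
  This lets extensions be composed and inverted.\<close>

lemma preserving_extension_image:
  assumes e: "preserving_extension Q \<phi> \<psi>" and Q: "subgroup Q P"
  shows "\<psi> ` (W <#> Q) = W <#> (\<phi> ` Q)"
proof -
  have \<psi>: "\<psi> \<in> Hom (W <#> Q) (carrier P)" "\<And>z. z \<in> Q \<Longrightarrow> \<psi> z = \<phi> z" "\<psi> ` W = W"
    using e by (auto simp: preserving_extension_def)
  have m: "\<psi> (w \<otimes> q) = \<psi> w \<otimes> \<phi> q" if "w \<in> W" "q \<in> Q" for w q
    using HomD(6)[OF \<psi>(1), of w q] W_le_mult[OF Q] le_W_mult[OF Q] that \<psi>(2) by auto
  show ?thesis
  proof
    show "\<psi> ` (W <#> Q) \<subseteq> W <#> (\<phi> ` Q)"
    proof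
      fix u assume "u \<in> \<psi> ` (W <#> Q)"
      then obtain w q where wq: "w \<in> W" "q \<in> Q" "u = \<psi> (w \<otimes> q)" by (auto simp: set_mult_def)
      then have "\<psi> w \<in> W" "\<phi> q \<in> \<phi> ` Q" using \<psi>(3) by auto
      then show "u \<in> W <#> (\<phi> ` Q)" unfolding wq(3) m[OF wq(1,2)] by (rule W_multI)
    qed
    show "W <#> (\<phi> ` Q) \<subseteq> \<psi> ` (W <#> Q)"
    proof
      fix u assume "u \<in> W <#> (\<phi> ` Q)"
      then obtain v q where "v \<in> W" and q: "q \<in> Q" and u: "u = v \<otimes> \<phi> q"
        by (auto simp: set_mult_def)
      then obtain w where w: "w \<in> W" "v = \<psi> w" using \<psi>(3) by blast
      then have "u = \<psi> (w \<otimes> q)" using m q u by simp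
      then show "u \<in> \<psi> ` (W <#> Q)" using W_multI[OF w(1) q] by blast
    qed
  qed
qed

lemma W_extendable_compose:
  assumes Q: "subgroup Q P" and f: "W_extendable Q f" and g: "W_extendable (f ` Q) g"
  shows "W_extendable Q (\<lambda>z. g (f z))"
proof -
  obtain \<psi> where e: "preserving_extension Q f \<psi>" using f by (auto simp: W_extendable_def)
  obtain \<theta> where d: "preserving_extension (f ` Q) g \<theta>" using g by (auto simp: W_extendable_def)
  have \<psi>: "\<psi> \<in> Hom (W <#> Q) (carrier P)" "\<And>z. z \<in> Q \<Longrightarrow> \<psi> z = f z" "\<psi> ` W = W"
    using e by (auto simp: preserving_extension_def)
  have \<theta>: "\<theta> \<in> Hom (W <#> (f ` Q)) (carrier P)" "\<And>z. z \<in> f ` Q \<Longrightarrow> \<theta> z = g z" "\<theta> ` W = W"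
    using d by (auto simp: preserving_extension_def)
  have "\<psi> \<in> Hom (W <#> Q) (W <#> (f ` Q))"
    using Hom_codomain[OF \<psi>(1)] preserving_extension_image[OF e Q] HomD(1)[OF \<theta>(1)] by simp
  then have "compose (W <#> Q) \<theta> \<psi> \<in> Hom (W <#> Q) (carrier P)" using Hom_compose \<theta>(1) by blast
  moreover have "\<forall>z \<in> Q. compose (W <#> Q) \<theta> \<psi> z = g (f z)"
    using le_W_mult[OF Q] \<psi>(2) \<theta>(2) by (auto simp: compose_def)
  moreover have "compose (W <#> Q) \<theta> \<psi> ` W = W"
  proof -
    have "compose (W <#> Q) \<theta> \<psi> ` W = \<theta> ` \<psi> ` W"
      unfolding image_image using W_le_mult[OF Q] by (intro image_cong) (auto simp: compose_def)
    then show ?thesis using \<psi>(3) \<theta>(3) by simp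
  qed
  ultimately show ?thesis unfolding W_extendable_def preserving_extension_def by blast
qed

lemma W_extendable_inverse:
  assumes Q: "subgroup Q P" and f: "W_extendable Q f" and g: "\<And>z. z \<in> Q \<Longrightarrow> g (f z) = z"
  shows "W_extendable (f ` Q) g"
proof -
  obtain \<psi> where e: "preserving_extension Q f \<psi>" using f by (auto simp: W_extendable_def)
  have \<psi>: "\<psi> \<in> Hom (W <#> Q) (carrier P)" "\<And>z. z \<in> Q \<Longrightarrow> \<psi> z = f z" "\<psi> ` W = W"
    using e by (auto simp: preserving_extension_def)
  define \<theta> where "\<theta> = restrict (inv_into (W <#> Q) \<psi>) (W <#> (f ` Q))"
  have "\<theta> \<in> Hom (W <#> (f ` Q)) (W <#> Q)"
    unfolding \<theta>_def by (rule Hom_inverse[OF \<psi>(1) preserving_extension_image[OF e Q]])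
  then have "\<theta> \<in> Hom (W <#> (f ` Q)) (carrier P)" by (rule Hom_carrierI)
  moreover have inv: "\<theta> (\<psi> z) = z" if "z \<in> W <#> Q" for z
    using inv_into_f_f[OF HomD(4)[OF \<psi>(1)] that] preserving_extension_image[OF e Q] that
    by (auto simp: \<theta>_def)
  have "\<forall>z \<in> f ` Q. \<theta> z = g z"
  proof
    fix u assume "u \<in> f ` Q"
    then obtain z where z: "z \<in> Q" "u = f z" by blast
    then have "\<theta> u = z" using \<psi>(2)[OF z(1)] inv[of z] le_W_mult[OF Q] by auto
    then show "\<theta> u = g u" using z g by simp
  qed
  moreover have "\<theta> ` W = W"
  proof -
    have "\<theta> ` W = \<theta> ` \<psi> ` W" using \<psi>(3) by simp
    also have "\<dots> = id ` W"
      unfolding image_image using inv W_le_mult[OF Q] by (intro image_cong) auto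
    finally show ?thesis by simp
  qed
  ultimately show ?thesis unfolding W_extendable_def preserving_extension_def by blast
qed

text \<open>Serves two purposes: passing from \<open>S\<close> to a subgroup, and replacing a
  function by another with the same values on \<open>Q\<close>.\<close>

lemma W_extendable_restrict:
  assumes Q: "subgroup Q P" and S: "subgroup S P" "Q \<subseteq> S" and g: "W_extendable S g"
    and eq: "\<And>z. z \<in> Q \<Longrightarrow> g z = f z"
  shows "W_extendable Q f"
proof -
  obtain \<psi> where \<psi>: "\<psi> \<in> Hom (W <#> S) (carrier P)" "\<And>z. z \<in> S \<Longrightarrow> \<psi> z = g z" "\<psi> ` W = W"
    using g by (auto simp: W_extendable_def preserving_extension_def)
  have sub: "W <#> Q \<subseteq> W <#> S" using S(2) by (auto simp: set_mult_def)
  have "restrict \<psi> (W <#> Q) \<in> Hom (W <#> Q) (carrier P)"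
    by (rule Hom_restrict[OF \<psi>(1) W_mult_subgroup[OF Q] sub])
  moreover have "\<forall>z \<in> Q. restrict \<psi> (W <#> Q) z = f z"
    using le_W_mult[OF Q] \<psi>(2) S(2) eq by auto
  moreover have "restrict \<psi> (W <#> Q) ` W = W"
    using W_le_mult[OF Q] \<psi>(3) by (auto simp: image_def subset_iff)
  ultimately show ?thesis unfolding W_extendable_def preserving_extension_def by blast
qed

lemma W_extendable_preserves:
  assumes "W_extendable Q f" "W \<subseteq> Q"
  shows "f ` W = W"
proof -
  obtain \<psi> where "\<And>z. z \<in> Q \<Longrightarrow> \<psi> z = f z" "\<psi> ` W = W"
    using assms(1) by (auto simp: W_extendable_def preserving_extension_def)
  moreover from this have "f ` W = \<psi> ` W" using assms(2) by (intro image_cong) auto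
  ultimately show ?thesis by simp
qed

lemma W_extendableI:
  assumes "\<phi> \<in> Hom Q R" "W \<subseteq> Q" "\<phi> ` W = W"
  shows "W_extendable Q \<phi>"
  using assms Hom_carrierI[OF assms(1)] W_mult_absorb[OF HomD(1)[OF assms(1)] assms(2)]
  by (auto simp: W_extendable_def preserving_extension_def)

text \<open>The center \<open>V\<close> of \<open>Q\<close> is abelian and invariant under
  \<open>N Q\<close>, and \<open>x [^] p\<close> acts trivially on it because it lies in
  \<open>Q\<close>. So conjugation by \<open>x\<close> is unipotent of order dividing
  \<open>p\<close> on \<open>V\<close>.\<close>

lemma normalizer_fixes_center_powers:
  assumes Q: "subgroup Q P" and x: "x \<in> N Q" "x [^] p \<in> Q"
    and v: "v \<in> Q" "\<forall>z \<in> Q. z \<otimes> v = v \<otimes> z"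
  shows "conjm P x (v [^] (p ^ n)) = v [^] (p ^ n)"
proof -
  define V where "V = {v \<in> Q. \<forall>z \<in> Q. z \<otimes> v = v \<otimes> z}"
  have Qc: "z \<in> carrier P" if "z \<in> Q" for z by (rule subgroup.mem_carrier[OF Q that])
  have xc: "x \<in> carrier P" by (rule N_D(1)[OF x(1)])
  show ?thesis
  proof (rule nilpotent_conj_fixes_prime_power[OF prime_p nil _ _ xc, of V])
    show "subgroup V P" unfolding V_def by (rule center_of_subgroup_is_subgroup[OF Q])
    show "v \<in> V" using v unfolding V_def by blast
    show "u \<otimes> w = w \<otimes> u" if "u \<in> V" "w \<in> V" for u w using that unfolding V_def by blast
    show "conjm P (x [^] p) u = u" if "u \<in> V" for u
      using that x(2) conjm_eq_iff_commute[OF Qc Qc, of "x [^] p" u] unfolding V_def by blast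
    show "conjm P x ` V \<subseteq> V"
    proof
      fix u assume "u \<in> conjm P x ` V"
      then obtain w where w: "w \<in> V" "u = conjm P x w" by blast
      have "u \<in> Q" using w N_D(2)[OF x(1)] by (auto simp: V_def)
      moreover have "z \<otimes> u = u \<otimes> z" if z: "z \<in> Q" for z
      proof -
        obtain y where y: "y \<in> Q" "z = conjm P x y" using N_D(2)[OF x(1)] z by blast
        have c: "y \<in> carrier P" "w \<in> carrier P" using y w Qc by (auto simp: V_def)
        have "z \<otimes> u = conjm P x (y \<otimes> w)" using y w c xc by (simp add: conjm_mult)
        also have "\<dots> = conjm P x (w \<otimes> y)" using w(1) y(1) unfolding V_def by auto
        also have "\<dots> = u \<otimes> z" using y w c xc by (simp add: conjm_mult)
        finally show ?thesis .
      qed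
      ultimately show "u \<in> V" unfolding V_def by blast
    qed
  qed
qed

text \<open>Automorphisms of \<open>Q\<close> preserve its center and commute with taking powers, so
  they permute the \<open>p ^ n\<close>-th powers of central elements. The pointwise stabilizer of
  an invariant set is normal.\<close>

lemma AutF_fixing_center_powers_normal:
  assumes Q: "subgroup Q P"
  shows "{\<kappa> \<in> Hom Q Q. \<forall>v \<in> Q. (\<forall>z \<in> Q. z \<otimes> v = v \<otimes> z) \<longrightarrow> \<kappa> (v [^] (p ^ n)) = v [^] (p ^ n)}
    \<lhd> AutF Hom Q" (is "?K \<lhd> ?A")
proof -
  interpret A: group ?A by (rule AutF_group[OF Q])
  define V where "V = {v \<in> Q. \<forall>z \<in> Q. z \<otimes> v = v \<otimes> z}"
  let ?L = "{\<kappa> \<in> Hom Q Q. \<forall>v \<in> V. \<kappa> (v [^] (p ^ n)) = v [^] (p ^ n)}"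
  have K: "?K = ?L"
    by (auto simp: V_def)
  have pQ: "v [^] (k::nat) \<in> Q" if "v \<in> Q" for v k
    by (induction k) (use that subgroup.one_closed[OF Q] subgroup.m_closed[OF Q] in auto)
  have vQ: "v [^] (p ^ n) \<in> Q" if "v \<in> V" for v using that pQ by (simp add: V_def)
  have iQ: "inv\<^bsub>?A\<^esub> \<phi> \<in> Hom Q Q" if "\<phi> \<in> Hom Q Q" for \<phi>
    using A.inv_closed that by simp
  have inv1: "(inv\<^bsub>?A\<^esub> \<phi>) (\<phi> z) = z" if "\<phi> \<in> Hom Q Q" "z \<in> Q" for \<phi> z
    using A.l_inv[of \<phi>] mult_AutF[OF that(2), of "inv\<^bsub>?A\<^esub> \<phi>" \<phi>] one_AutF[OF that(2)] that(1) by simp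
  have inv2: "\<phi> ((inv\<^bsub>?A\<^esub> \<phi>) z) = z" if "\<phi> \<in> Hom Q Q" "z \<in> Q" for \<phi> z
    using A.r_inv[of \<phi>] mult_AutF[OF that(2), of \<phi> "inv\<^bsub>?A\<^esub> \<phi>"] one_AutF[OF that(2)] that(1) by simp
  have VV: "\<phi> v \<in> V" if \<phi>: "\<phi> \<in> Hom Q Q" and v: "v \<in> V" for \<phi> v
  proof -
    have vq: "v \<in> Q" using v by (simp add: V_def)
    have "z \<otimes> \<phi> v = \<phi> v \<otimes> z" if z: "z \<in> Q" for z
    proof -
      obtain y where y: "y \<in> Q" "z = \<phi> y" using Hom_Aut_image[OF \<phi>] z by blast
      have "y \<otimes> v = v \<otimes> y" using v y(1) unfolding V_def by blast
      then have "\<phi> (y \<otimes> v) = \<phi> (v \<otimes> y)" by simp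
      then show ?thesis using HomD(6)[OF \<phi>] y vq by simp
    qed
    then show ?thesis using Hom_carrier(1)[OF \<phi> vq] unfolding V_def by blast
  qed
  show ?thesis unfolding K
  proof (rule A.normal_invI)
    show "subgroup ?L ?A"
    proof (rule A.subgroupI)
      show "?L \<subseteq> carrier ?A" by auto
      have "\<one>\<^bsub>?A\<^esub> \<in> Hom Q Q" using A.one_closed by simp
      then show "?L \<noteq> {}"
        using vQ by (auto intro!: exI[of _ "\<one>\<^bsub>?A\<^esub>"])
    next
      fix a assume a: "a \<in> ?L"
      have "(inv\<^bsub>?A\<^esub> a) (v [^] (p ^ n)) = v [^] (p ^ n)" if "v \<in> V" for v
        using inv1[of a "v [^] (p ^ n)"] a that vQ by auto
      then show "inv\<^bsub>?A\<^esub> a \<in> ?L"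
        using a iQ by auto
    next
      fix a b assume ab: "a \<in> ?L"
        "b \<in> ?L"
      then have "a \<otimes>\<^bsub>?A\<^esub> b \<in> Hom Q Q" using A.m_closed[of a b] by simp
      then show "a \<otimes>\<^bsub>?A\<^esub> b \<in> ?L"
        using ab vQ by auto
    qed
  next
    fix \<phi> \<kappa> assume \<phi>: "\<phi> \<in> carrier ?A"
      and \<kappa>: "\<kappa> \<in> ?L"
    have \<phi>': "\<phi> \<in> Hom Q Q" using \<phi> by simp
    have "\<phi> \<otimes>\<^bsub>?A\<^esub> \<kappa> \<otimes>\<^bsub>?A\<^esub> inv\<^bsub>?A\<^esub> \<phi> \<in> Hom Q Q"
      using A.m_closed[OF A.m_closed[OF \<phi>] A.inv_closed[OF \<phi>], of \<kappa>] \<kappa> by simp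
    moreover have "(\<phi> \<otimes>\<^bsub>?A\<^esub> \<kappa> \<otimes>\<^bsub>?A\<^esub> inv\<^bsub>?A\<^esub> \<phi>) (v [^] (p ^ n)) = v [^] (p ^ n)" if v: "v \<in> V" for v
    proof -
      let ?i = "inv\<^bsub>?A\<^esub> \<phi>"
      have vq: "v \<in> Q" using v by (simp add: V_def)
      have "?i (v [^] (p ^ n)) = ?i v [^] (p ^ n)" by (rule Hom_nat_pow[OF iQ[OF \<phi>'] vq])
      then have "\<kappa> (?i (v [^] (p ^ n))) = ?i (v [^] (p ^ n))"
        using \<kappa> VV[OF iQ[OF \<phi>'] v] by simp
      then show ?thesis
        using vQ[OF v] Hom_carrier(1)[OF iQ[OF \<phi>'] vQ[OF v]] inv2[OF \<phi>' vQ[OF v]] by simp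
    qed
    ultimately show "\<phi> \<otimes>\<^bsub>?A\<^esub> \<kappa> \<otimes>\<^bsub>?A\<^esub> inv\<^bsub>?A\<^esub> \<phi> \<in> ?L"
      by blast
  qed
qed

text \<open>Automorphisms that extend beyond \<open>Q\<close> are covered by \<open>IH\<close>. The
  remaining ones are, by the Frattini argument, products of one that fixes \<open>W\<close>
  pointwise and one that does extend.\<close>

lemma W_extendable_AutF:
  assumes Q: "fully_normalized P Hom Q" "Q \<noteq> carrier P"
    and IH: "\<And>S \<psi>. \<lbrakk>\<psi> \<in> Hom S (carrier P); card Q < card S\<rbrakk> \<Longrightarrow> W_extendable S \<psi>"
    and h: "h \<in> Hom Q Q"
  shows "W_extendable Q h"
proof -
  have Qs: "subgroup Q P" using Q(1) by (simp add: fully_normalized_def)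
  have Qc: "z \<in> carrier P" if "z \<in> Q" for z by (rule subgroup.mem_carrier[OF Qs that])
  interpret A: group "AutF Hom Q" by (rule AutF_group[OF Qs])
  \<comment> \<open>Saturation extends \<open>f\<close> to \<open>N_phi P Q f\<close>; a single
    element outside \<open>Q\<close> makes this domain larger than \<open>Q\<close>, so that
    \<open>IH\<close> applies.\<close>
  have larger: "\<exists>S \<psi>. Q \<subseteq> S \<and> subgroup S P \<and> W_extendable S \<psi> \<and> (\<forall>z \<in> Q. \<psi> z = f z)"
    if f: "f \<in> Hom Q Q" and x: "x \<in> N_phi P Q f" "x \<notin> Q" for f x
  proof -
    obtain \<psi> where \<psi>: "\<psi> \<in> Hom (N_phi P Q f) (carrier P)" "\<And>z. z \<in> Q \<Longrightarrow> \<psi> z = f z"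
      using extension[OF f Hom_Aut_image[OF f] Q(1)] by blast
    have S: "subgroup (N_phi P Q f) P" by (rule HomD(1)[OF \<psi>(1)])
    have sub: "Q \<subseteq> N_phi P Q f" by (rule le_N_phi[OF f Hom_Aut_image[OF f]])
    then have "Q \<subset> N_phi P Q f" using x by blast
    then have "card Q < card (N_phi P Q f)" by (rule psubset_card_mono[OF fin_subgroup[OF S]])
    then have "W_extendable (N_phi P Q f) \<psi>" by (rule IH[OF \<psi>(1)])
    then show ?thesis using S sub \<psi>(2) by blast
  qed
  show ?thesis
  proof (cases "\<exists>x \<in> carrier P. x \<notin> Q \<and> (\<forall>z \<in> Q. x \<otimes> z = z \<otimes> x)")
    case True
    then obtain x where x: "x \<in> carrier P" "x \<notin> Q" "\<And>z. z \<in> Q \<Longrightarrow> x \<otimes> z = z \<otimes> x" by blast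
    then have cx: "conjm P x z = z" if "z \<in> Q" for z using that Qc by (simp add: conjm_eq_iff_commute)
    \<comment> \<open>As \<open>x\<close> acts trivially on \<open>Q\<close>, it belongs to
      \<open>N_phi\<close> with witness \<open>\<one>\<close>.\<close>
    have "x \<in> N Q" using x(1) cx by (simp add: normalizer_in_def)
    moreover have "\<one> \<in> N (h ` Q)"
      using subgroup.one_closed[OF N_subgroup[OF Hom_image_subgroup[OF h Qs subset_refl]]] .
    ultimately have "x \<in> N_phi P Q h"
      using cx Hom_carrier(2)[OF h] by (auto simp: N_phi_def intro!: bexI[of _ \<one>])
    then show ?thesis using larger[OF h _ x(2)] W_extendable_restrict[OF Qs] by blast
  next
    case False
    then have cent: "x \<in> Q" if "x \<in> carrier P" "\<And>z. z \<in> Q \<Longrightarrow> x \<otimes> z = z \<otimes> x" for x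
      using that by blast
    have ZQ: "grp_center P \<subseteq> Q"
    proof
      fix a assume a: "a \<in> grp_center P"
      show "a \<in> Q" by (rule cent) (use a Qc in \<open>unfold grp_center_def, auto\<close>)
    qed
    have pQ: "v [^] (k::nat) \<in> Q" if "v \<in> Q" for v k
      by (induction k) (use that subgroup.one_closed[OF Qs] subgroup.m_closed[OF Qs] in auto)
    have WQ: "W \<subseteq> Q" using ZQ pQ W_powers by auto
    define K where "K = {\<kappa> \<in> Hom Q Q. \<forall>v \<in> Q. (\<forall>z \<in> Q. z \<otimes> v = v \<otimes> z) \<longrightarrow> \<kappa> (v [^] (p ^ n)) = v [^] (p ^ n)}"
    have K: "K \<lhd> AutF Hom Q" unfolding K_def by (rule AutF_fixing_center_powers_normal[OF Qs])
    obtain k where k: "card (AutP P Q) = p ^ k" using AutP_subgroup(2)[OF Qs] by blast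
    obtain \<kappa> \<nu> where \<kappa>: "\<kappa> \<in> K" and \<nu>: "\<nu> \<in> carrier (AutF Hom Q)" and h\<kappa>\<nu>: "h = \<kappa> \<otimes>\<^bsub>AutF Hom Q\<^esub> \<nu>"
      and norm: "\<And>s. s \<in> AutP P Q \<inter> K \<Longrightarrow> \<nu> \<otimes>\<^bsub>AutF Hom Q\<^esub> s \<otimes>\<^bsub>AutF Hom Q\<^esub> inv\<^bsub>AutF Hom Q\<^esub> \<nu> \<in> AutP P Q \<inter> K"
      using A.Frattini_argument[OF prime_p _ AutP_subgroup(1)[OF Qs] k fully_normalized_Sylow[OF Q(1)] K, of h]
        finite_AutF h by auto
    have \<nu>': "\<nu> \<in> Hom Q Q" using \<nu> by simp
    obtain m where m: "card (N Q) = p ^ m" using card_subgroup_p_power[OF N_subgroup[OF Qs]] by blast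
    obtain x where x: "x \<in> N Q" "x \<notin> Q" "x [^] p \<in> Q"
      using order_p_modulo_subgroup[OF prime_p N_subgroup[OF Qs] m Qs Q_psubset_N[OF Qs Q(2)]] .
    let ?c = "restrict (conjm P x) Q"
    \<comment> \<open>This is where the class bound enters. Conjugation by \<open>x\<close> lies in
      \<open>AutP P Q \<inter> K\<close>, which \<open>\<nu>\<close> normalizes, so \<open>x\<close>
      belongs to \<open>N_phi P Q \<nu>\<close>.\<close>
    have "?c \<in> K"
      using conj_AutF[OF Qs x(1)] normalizer_fixes_center_powers[OF Qs x(1,3)] pQ by (simp add: K_def)
    moreover have "?c \<in> AutP P Q" using x(1) by (auto simp: AutP_def)
    ultimately obtain y where y: "y \<in> N Q"
      "\<nu> \<otimes>\<^bsub>AutF Hom Q\<^esub> ?c \<otimes>\<^bsub>AutF Hom Q\<^esub> inv\<^bsub>AutF Hom Q\<^esub> \<nu> = restrict (conjm P y) Q"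
      using norm[of ?c] by (auto simp: AutP_def)
    have "\<nu> (conjm P x z) = conjm P y (\<nu> z)" if z: "z \<in> Q" for z
    proof -
      have nz: "\<nu> z \<in> Q" by (rule Hom_carrier(1)[OF \<nu>' z])
      have "(inv\<^bsub>AutF Hom Q\<^esub> \<nu>) (\<nu> z) = z"
        using A.l_inv[OF \<nu>] mult_AutF[OF z, of "inv\<^bsub>AutF Hom Q\<^esub> \<nu>" \<nu>] one_AutF[OF z] by simp
      then have "(\<nu> \<otimes>\<^bsub>AutF Hom Q\<^esub> ?c \<otimes>\<^bsub>AutF Hom Q\<^esub> inv\<^bsub>AutF Hom Q\<^esub> \<nu>) (\<nu> z) = \<nu> (conjm P x z)"
        using nz z by simp
      then show ?thesis using y(2) nz by simp
    qed
    then have "x \<in> N_phi P Q \<nu>" using x(1) y(1) Hom_Aut_image[OF \<nu>'] by (auto simp: N_phi_def)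
    then have "W_extendable Q \<nu>" using larger[OF \<nu>' _ x(2)] W_extendable_restrict[OF Qs] by blast
    then have \<nu>W: "\<nu> ` W = W" by (rule W_extendable_preserves[OF _ WQ])
    \<comment> \<open>The center of \<open>P\<close> lies in \<open>Q\<close>, hence in the center
      of \<open>Q\<close>; so elements of \<open>W\<close> are among the powers fixed by
      \<open>K\<close>.\<close>
    have \<kappa>w: "\<kappa> w = w" if w: "w \<in> W" for w
    proof -
      obtain a where a: "a \<in> grp_center P" "w = a [^] (p ^ n)" using w W_powers by auto
      then have "a \<in> Q" "\<forall>z \<in> Q. z \<otimes> a = a \<otimes> z" using a(1) ZQ Qc unfolding grp_center_def by auto
      then show ?thesis using \<kappa> a(2) by (simp add: K_def)
    qed
    have "h w = \<nu> w" if w: "w \<in> W" for w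
    proof -
      have "\<nu> w \<in> W" using \<nu>W w by blast
      then show ?thesis using h\<kappa>\<nu> w WQ \<kappa>w by auto
    qed
    then have "h ` W = W" using \<nu>W image_cong[of W W h \<nu>] by simp
    then show ?thesis by (rule W_extendableI[OF h WQ])
  qed
qed

section \<open>Arbitrary morphisms, by downward induction\<close>

lemma Hom_carrier_preserves_W:
  assumes \<phi>: "\<phi> \<in> Hom (carrier P) (carrier P)"
  shows "\<phi> ` W = W"
proof (rule endo_inj_surj[OF fin_subgroup[OF W_subgroup]])
  show "inj_on \<phi> W" using HomD(4)[OF \<phi>] subgroup.subset[OF W_subgroup] by (rule inj_on_subset)
  show "\<phi> ` W \<subseteq> W"
  proof
    fix u assume "u \<in> \<phi> ` W"
    then obtain a where a: "a \<in> grp_center P" "u = \<phi> (a [^] (p ^ n))" using W_powers by auto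
    have ac: "a \<in> carrier P" using a(1) by (simp add: grp_center_def)
    have "z \<otimes> \<phi> a = \<phi> a \<otimes> z" if z: "z \<in> carrier P" for z
    proof -
      obtain y where y: "y \<in> carrier P" "z = \<phi> y" using Hom_Aut_image[OF \<phi>] z by blast
      have "y \<otimes> a = a \<otimes> y" using a(1) y(1) unfolding grp_center_def by blast
      then have "\<phi> (y \<otimes> a) = \<phi> (a \<otimes> y)" by simp
      then show ?thesis using HomD(6)[OF \<phi>] y ac by simp
    qed
    then have "\<phi> a \<in> grp_center P" using Hom_carrier(1)[OF \<phi> ac] unfolding grp_center_def by blast
    moreover have "u = \<phi> a [^] (p ^ n)" using a(2) Hom_nat_pow[OF \<phi> ac] by simp
    ultimately show "u \<in> W" using W_powers by auto
  qed
qed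

text \<open>With \<open>T\<close> a fully normalized conjugate of \<open>Q\<close>, the morphism is
  decomposed as an isomorphism from \<open>Q\<close> to \<open>T\<close>, an automorphism
  \<open>\<delta>\<close> of \<open>T\<close>, and the inverse of an isomorphism from the image
  \<open>R\<close> to \<open>T\<close>. Each factor is extendable.\<close>

theorem Hom_W_extendable: "\<phi> \<in> Hom Q (carrier P) \<Longrightarrow> W_extendable Q \<phi>"
proof (induction "card (carrier P) - card Q" arbitrary: Q \<phi> rule: less_induct)
  case less
  note \<phi> = less.prems
  have Qs: "subgroup Q P" by (rule HomD(1)[OF \<phi>])
  show ?case
  proof (cases "Q = carrier P")
    case True
    then show ?thesis
      using W_extendableI[OF \<phi>] Hom_carrier_preserves_W subgroup.subset[OF W_subgroup] \<phi> by simp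
  next
    case False
    have IH: "W_extendable S \<psi>" if \<psi>: "\<psi> \<in> Hom S (carrier P)" and c: "card Q < card S" for S \<psi>
    proof (rule less.hyps[OF _ \<psi>])
      have "card S \<le> card (carrier P)"
        by (rule card_mono[OF finP subgroup.subset[OF HomD(1)[OF \<psi>]]])
      then show "card (carrier P) - card S < card (carrier P) - card Q" using c by linarith
    qed
    \<comment> \<open>Up to an automorphism \<open>\<beta>\<close> of \<open>T\<close>, an
      isomorphism onto \<open>T\<close> extends to the normalizer of \<open>R\<close>, which is
      strictly larger than \<open>R\<close>; there the induction hypothesis applies.\<close>
    have ext: "\<exists>\<beta> \<in> Hom T T. W_extendable R (\<lambda>z. \<beta> (\<alpha> z))"
      if T: "fully_normalized P Hom T" and \<alpha>: "\<alpha> \<in> Hom R T" "\<alpha> ` R = T"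
        and R: "card R = card Q" for R T \<alpha>
    proof -
      have Rs: "subgroup R P" by (rule HomD(1)[OF \<alpha>(1)])
      have "R \<noteq> carrier P"
        using False R card_subset_eq[OF finP subgroup.subset[OF Qs]] by metis
      then have RN: "R \<subset> N R" by (rule Q_psubset_N[OF Rs])
      obtain \<beta> S \<psi> where b: "\<beta> \<in> Hom T T" "N R \<subseteq> S" "\<psi> \<in> Hom S (carrier P)"
        "\<And>z. z \<in> R \<Longrightarrow> \<psi> z = \<beta> (\<alpha> z)"
        using Sylow_AutP_extension[OF T fully_normalized_Sylow[OF T] \<alpha>] by blast
      have Ss: "subgroup S P" by (rule HomD(1)[OF b(3)])
      have "R \<subset> S" using RN b(2) by blast
      then have "card Q < card S" using psubset_card_mono[OF fin_subgroup[OF Ss]] R by metis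
      then have "W_extendable S \<psi>" by (rule IH[OF b(3)])
      then have "W_extendable R (\<lambda>z. \<beta> (\<alpha> z))"
        by (rule W_extendable_restrict[OF Rs Ss psubset_imp_subset[OF \<open>R \<subset> S\<close>] _ b(4)])
      then show ?thesis using b(1) by blast
    qed
    obtain T \<alpha> where \<alpha>: "\<alpha> \<in> Hom Q T" "\<alpha> ` Q = T" and T: "fully_normalized P Hom T"
      using fully_normalized_exists[OF Qs] .
    have Ts: "subgroup T P" by (rule HomD(2)[OF \<alpha>(1)])
    have cT: "card T = card Q" using card_Hom_image[OF \<alpha>(1)] \<alpha>(2) by simp
    have Tn: "T \<noteq> carrier P"
      using False cT card_subset_eq[OF finP subgroup.subset[OF Qs]] by metis
    define R where "R = \<phi> ` Q"
    have Rs: "subgroup R P" unfolding R_def by (rule Hom_image_subgroup[OF \<phi> Qs subset_refl])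
    have cR: "card R = card Q" using card_Hom_image[OF \<phi>] by (simp add: R_def)
    define \<alpha>' where "\<alpha>' = compose R \<alpha> (restrict (inv_into Q \<phi>) R)"
    have \<alpha>': "\<alpha>' \<in> Hom R T"
      unfolding \<alpha>'_def by (rule Hom_compose[OF Hom_inverse[OF \<phi>] \<alpha>(1)]) (simp add: R_def)
    have \<alpha>'\<phi>: "\<alpha>' (\<phi> z) = \<alpha> z" if "z \<in> Q" for z
      using that inv_into_f_f[OF HomD(4)[OF \<phi>] that] by (simp add: \<alpha>'_def compose_def R_def)
    have \<alpha>'im: "\<alpha>' ` R = T" using \<alpha>'\<phi> \<alpha>(2) by (force simp: R_def image_image)
    obtain \<beta>1 where \<beta>1: "\<beta>1 \<in> Hom T T" "W_extendable Q (\<lambda>z. \<beta>1 (\<alpha> z))"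
      using ext[OF T \<alpha> refl] by blast
    obtain \<beta>2 where \<beta>2: "\<beta>2 \<in> Hom T T" "W_extendable R (\<lambda>z. \<beta>2 (\<alpha>' z))"
      using ext[OF T \<alpha>' \<alpha>'im cR] by blast
    \<comment> \<open>The two isomorphisms onto \<open>T\<close> were corrected by different
      automorphisms \<open>\<beta>1\<close> and \<open>\<beta>2\<close>; \<open>\<delta>\<close>
      compensates for the difference.\<close>
    define \<delta> where "\<delta> = compose T \<beta>2 (restrict (inv_into T \<beta>1) T)"
    have \<delta>: "\<delta> \<in> Hom T T"
      unfolding \<delta>_def by (rule Hom_compose[OF Hom_inverse[OF \<beta>1(1) Hom_Aut_image[OF \<beta>1(1)]] \<beta>2(1)])
    have \<delta>\<beta>: "\<delta> (\<beta>1 z) = \<beta>2 z" if "z \<in> T" for z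
      using that inv_into_f_f[OF HomD(4)[OF \<beta>1(1)] that] Hom_carrier(1)[OF \<beta>1(1) that]
      by (simp add: \<delta>_def compose_def)
    have "W_extendable T \<delta>"
      by (rule W_extendable_AutF[OF T Tn _ \<delta>]) (use IH cT in simp)
    moreover have im1: "(\<lambda>z. \<beta>1 (\<alpha> z)) ` Q = T"
      using \<alpha>(2) Hom_Aut_image[OF \<beta>1(1)] by (auto simp: image_image[symmetric])
    ultimately have "W_extendable Q (\<lambda>z. \<delta> (\<beta>1 (\<alpha> z)))"
      using W_extendable_compose[OF Qs \<beta>1(2)] by simp
    then have 1: "W_extendable Q (\<lambda>z. \<beta>2 (\<alpha> z))"
      by (rule W_extendable_restrict[OF Qs Qs subset_refl])
         (use \<delta>\<beta> Hom_carrier(1)[OF \<alpha>(1)] in simp)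
    define \<theta> where "\<theta> = inv_into R (\<lambda>z. \<beta>2 (\<alpha>' z))"
    have inj: "inj_on (\<lambda>z. \<beta>2 (\<alpha>' z)) R"
      using HomD(4)[OF \<alpha>'] HomD(4)[OF \<beta>2(1)] Hom_carrier(1)[OF \<alpha>'] by (auto simp: inj_on_def)
    have \<theta>: "\<theta> (\<beta>2 (\<alpha>' z)) = z" if "z \<in> R" for z
      unfolding \<theta>_def using inv_into_f_f[OF inj that] by simp
    have 2: "W_extendable ((\<lambda>z. \<beta>2 (\<alpha>' z)) ` R) \<theta>"
      by (rule W_extendable_inverse[OF Rs \<beta>2(2) \<theta>])
    have "(\<lambda>z. \<beta>2 (\<alpha>' z)) ` R = (\<lambda>z. \<beta>2 (\<alpha> z)) ` Q"
      unfolding R_def image_image using \<alpha>'\<phi> by (intro image_cong) auto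
    \<comment> \<open>Since \<open>\<alpha>\<close> equals \<open>\<alpha>'\<close> after
      \<open>\<phi>\<close>, and \<open>\<theta>\<close> inverts \<open>\<beta>2\<close> after
      \<open>\<alpha>'\<close>, this composite agrees with \<open>\<phi>\<close> on
      \<open>Q\<close>.\<close>
    then have "W_extendable Q (\<lambda>z. \<theta> (\<beta>2 (\<alpha> z)))"
      using W_extendable_compose[OF Qs 1] 2 by simp
    then show ?thesis
    proof (rule W_extendable_restrict[OF Qs Qs subset_refl])
      fix z assume z: "z \<in> Q"
      then have "\<phi> z \<in> R" by (simp add: R_def)
      then show "\<theta> (\<beta>2 (\<alpha> z)) = \<phi> z" using \<theta>[of "\<phi> z"] \<alpha>'\<phi>[OF z] by simp
    qed
  qed
qed

theorem W_normal_in_fusion: "normal_in_fusion P Hom W"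
  unfolding normal_in_fusion_def
proof (intro conjI allI impI)
  show "subgroup W P" by (rule W_subgroup)
  show "N W = carrier P" by (rule normalizer_in_W)
  fix Q R \<phi> assume \<phi>: "\<phi> \<in> Hom Q R"
  have Q: "subgroup Q P" and R: "subgroup R P" using HomD(1,2)[OF \<phi>] .
  obtain \<psi> where e: "preserving_extension Q \<phi> \<psi>"
    using Hom_W_extendable[OF Hom_carrierI[OF \<phi>]] by (auto simp: W_extendable_def)
  have \<psi>: "\<psi> \<in> Hom (W <#> Q) (carrier P)" "\<And>z. z \<in> Q \<Longrightarrow> \<psi> z = \<phi> z" "\<psi> ` W = W"
    using e by (auto simp: preserving_extension_def)
  have "\<psi> \<in> Hom (W <#> Q) (W <#> R)"
  proof (rule Hom_codomain[OF \<psi>(1) _ W_mult_subgroup[OF R]])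
    show "\<psi> ` (W <#> Q) \<subseteq> W <#> R"
      using preserving_extension_image[OF e Q] mono_set_mult[OF subset_refl HomD(5)[OF \<phi>]] by simp
  qed
  then show "\<exists>\<psi>\<in>Hom (W <#> Q) (W <#> R). (\<forall>z\<in>Q. \<psi> z = \<phi> z) \<and> \<psi> ` W = W"
    using \<psi> by blast
qed

end

theorem theorem1p3:
  fixes P :: "('a, 'b) monoid_scheme" and Hom :: "'a homs" and p n :: nat
  assumes "Factorial_Ring.prime p"
    and "p_group p P"
    and "carrier P \<noteq> {\<one>\<^bsub>P\<^esub>}"
    and "nilpotent_class_le P (n * (p - 1) + 1)"
    and "saturated_fusion_system p P Hom"
  shows "normal_in_fusion P Hom (mho P p n (grp_center P))"
proof -
  have "group P" using assms(2) by (simp add: p_group_def)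
  then interpret saturated_fusion_nilpotent P Hom p n
    using assms by (simp add: saturated_fusion_nilpotent_def saturated_fusion_def
        saturated_fusion_axioms_def saturated_fusion_nilpotent_axioms_def)
  show ?thesis by (rule W_normal_in_fusion)
qed

end
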